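(* Let $G=B(m;R,S,T)$ be a connected bicirculant with $m$ even, $m\ge 4$, $|S|\ge 3$, and $m/2\in R$ and $m/2\in T$. Then $G$ is hamiltonian.
   Context: For an integer $m\ge 1$ and subsets $R,S,T\subseteq\mathbb{Z}_m$ with $R=-R$, $T=-T$, $0\notin R\cup T$, $0\in S$ and $|R|=|T|$, the bicirculant $B(m;R,S,T)$ is the graph with vertex set $\{u_0,\dots,u_{m-1}\}\cup\{v_0,\dots,v_{m-1}\}$ and edge set $\{u_iu_{i+j}: i\in\mathbb{Z}_m, j\in R\}\cup\{v_iv_{i+j}: i\in\mathbb{Z}_m, j\in T\}\cup\{u_iv_{i+j}: i\in\mathbb{Z}_m, j\in S\}$ (indices mod $m$). *)

theory Defs
  imports Main
begin

text \<open>Vertices of a bicirculant B(m;R,S,T): (False,i) is u_i, (True,i) is v_i, with i < m.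
  Subsets of Z_m are represented as sets of naturals below m.\<close>

definition bic_verts :: "nat \<Rightarrow> (bool \<times> nat) set" where
  "bic_verts m = UNIV \<times> {..<m}"

definition bic_adj :: "nat \<Rightarrow> nat set \<Rightarrow> nat set \<Rightarrow> nat set \<Rightarrow> bool \<times> nat \<Rightarrow> bool \<times> nat \<Rightarrow> bool" where
  "bic_adj m R S T x y =
    (snd x < m \<and> snd y < m \<and>
     ((\<not> fst x \<and> \<not> fst y \<and> (\<exists>j\<in>R. snd y = (snd x + j) mod m)) \<or>
      (fst x \<and> fst y \<and> (\<exists>j\<in>T. snd y = (snd x + j) mod m)) \<or>
      (\<not> fst x \<and> fst y \<and> (\<exists>j\<in>S. snd y = (snd x + j) mod m)) \<or>
      (fst x \<and> \<not> fst y \<and> (\<exists>j\<in>S. snd x = (snd y + j) mod m))))"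

text \<open>Symmetric subset of Z_m: closed under negation mod m.\<close>
definition symm_mod :: "nat \<Rightarrow> nat set \<Rightarrow> bool" where
  "symm_mod m A = (\<forall>j\<in>A. (m - j) mod m \<in> A)"

definition graph_connected :: "'v set \<Rightarrow> ('v \<Rightarrow> 'v \<Rightarrow> bool) \<Rightarrow> bool" where
  "graph_connected V adj = (\<forall>x\<in>V. \<forall>y\<in>V. (x, y) \<in> {(a, b). a \<in> V \<and> b \<in> V \<and> adj a b}\<^sup>*)"

text \<open>A Hamiltonian cycle: a cyclic ordering of all vertices (at least 3) with consecutive ones adjacent.\<close>
definition hamiltonian :: "'v set \<Rightarrow> ('v \<Rightarrow> 'v \<Rightarrow> bool) \<Rightarrow> bool" where
  "hamiltonian V adj = (\<exists>xs. distinct xs \<and> set xs = V \<and> length xs \<ge> 3 \<and>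
      (\<forall>i<length xs. adj (xs ! i) (xs ! ((i + 1) mod length xs))))"

end

theory Submission
  imports Defs
begin

text \<open>
  Put \<open>n = m / 2\<close>. Translation by \<open>n\<close> is a fixed-point-free involution \<open>\<tau>\<close> of the graph, and every vertex \<open>x\<close>
  is joined to \<open>\<tau> x\<close> by an edge, a rung. If disjoint cycles contain the rungs at \<open>x\<close> and at \<open>y\<close> and \<open>x\<close> is
  adjacent to \<open>y\<close>, replacing these two rungs by the edges \<open>{x, y}\<close> and \<open>{\<tau> x, \<tau> y}\<close> merges the cycles.

  Call a divisor \<open>d\<close> of \<open>n\<close> good if the vertices whose index lies in a given class mod \<open>d\<close> span a
  cycle, the same for all classes up to translation, with at least two rungs on the \<open>u\<close> side and two on
  the \<open>v\<close> side. Merging along the edges of a type \<open>s \<in> R \<union> S \<union> T\<close> shows that then \<open>gcd d s\<close> is good too, so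
  the least good \<open>d\<close> divides all of \<open>R \<union> S \<union> T\<close> and equals 1 by connectedness.

  For a first good \<open>d\<close>, suppose that \<open>0, a, b \<in> S\<close> are distinct mod \<open>n\<close>. The hexagon
  \<open>v\<^sub>0 u\<^sub>0 v\<^sub>a u\<^sub>a\<^sub>-\<^sub>b v\<^sub>a\<^sub>-\<^sub>b u\<^sub>-\<^sub>b\<close> lifts to a 12-cycle with six rungs, and the remaining vertices are absorbed by
  extending along the arcs of the cycles with steps \<open>0\<close> and \<open>a\<close> that it leaves out. If \<open>S\<close> has only two
  classes mod \<open>n\<close>, one of them contains two elements of \<open>S\<close>, and this makes a cycle with steps \<open>0\<close> and \<open>a\<close>
  close up when it passes through all of its rungs.
\<close>

section \<open>Cycles through the rungs of an involution\<close>

fun path_edges :: "'v list \<Rightarrow> 'v set set" where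
  "path_edges (x # y # xs) = insert {x, y} (path_edges (y # xs))"
| "path_edges _ = {}"

text \<open>A list of two vertices counts as a degenerate cycle along a single edge. At least three
  vertices are demanded only in \<open>hamiltonianI\<close>.\<close>

definition cycle_edges :: "'v list \<Rightarrow> 'v set set" where
  "cycle_edges xs = insert {last xs, hd xs} (path_edges xs)"

lemma path_edges_append:
  "xs \<noteq> [] \<Longrightarrow> ys \<noteq> [] \<Longrightarrow>
    path_edges (xs @ ys) = insert {last xs, hd ys} (path_edges xs \<union> path_edges ys)"
  by (induction xs rule: path_edges.induct) (auto simp: neq_Nil_conv)

lemma path_edges_rev: "path_edges (rev xs) = path_edges xs"
proof (induction xs rule: path_edges.induct)
  case (1 x y xs)
  then show ?case
    using path_edges_append[of "rev xs @ [y]" "[x]"] by (simp add: insert_commute)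
qed auto

lemma path_edges_subset: "e \<in> path_edges xs \<Longrightarrow> e \<subseteq> set xs"
  by (induction xs rule: path_edges.induct) auto

lemma path_edges_cover: "length xs \<ge> 2 \<Longrightarrow> x \<in> set xs \<Longrightarrow> \<exists>y. {x, y} \<in> path_edges xs"
proof (induction xs rule: path_edges.induct)
  case (1 u v xs)
  consider "x = u" | "x = v" | "x \<in> set xs" "x \<noteq> u" "x \<noteq> v" using 1 by auto
  then show ?case
  proof cases
    case 2
    then show ?thesis by (intro exI[of _ u]) (simp add: insert_commute)
  next
    case 3
    then have "length (v # xs) \<ge> 2" by (cases xs) auto
    then show ?thesis using 1 3 by auto
  qed auto
qed auto

lemma path_edges_split:
  assumes "{p, q} \<in> path_edges xs"
  shows "\<exists>ys zs. xs = ys @ zs \<and> ys \<noteq> [] \<and> zs \<noteq> [] \<and> {last ys, hd zs} = {p, q}"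
  using assms
proof (induction xs rule: path_edges.induct)
  case (1 x y xs)
  show ?case
  proof (cases "{p, q} = {x, y}")
    case True
    then have "x # y # xs = [x] @ (y # xs) \<and> {last [x], hd (y # xs)} = {p, q}"
      by simp
    then show ?thesis by blast
  next
    case False
    then obtain ys zs where "y # xs = ys @ zs" "ys \<noteq> []" "zs \<noteq> []" "{last ys, hd zs} = {p, q}"
      using 1 by auto
    then have "x # y # xs = (x # ys) @ zs \<and> x # ys \<noteq> [] \<and> zs \<noteq> [] \<and> {last (x # ys), hd zs} = {p, q}"
      by simp
    then show ?thesis by blast
  qed
qed auto

lemma path_edges_nth: "Suc i < length xs \<Longrightarrow> {xs ! i, xs ! Suc i} \<in> path_edges xs"
proof (induction xs arbitrary: i rule: path_edges.induct)
  case (1 x y xs)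
  then show ?case by (cases i) auto
qed auto

lemma cycle_edges_subset: "xs \<noteq> [] \<Longrightarrow> e \<in> cycle_edges xs \<Longrightarrow> e \<subseteq> set xs"
  unfolding cycle_edges_def using path_edges_subset by fastforce

lemma cycle_edges_rev: "cycle_edges (rev xs) = cycle_edges xs"
  by (simp add: cycle_edges_def path_edges_rev hd_rev last_rev insert_commute)

lemma cycle_edges_append_commute:
  "xs \<noteq> [] \<Longrightarrow> ys \<noteq> [] \<Longrightarrow> cycle_edges (xs @ ys) = cycle_edges (ys @ xs)"
  by (auto simp: cycle_edges_def path_edges_append)

text \<open>Rotation makes the given edge the closing one; a reversal, if necessary, puts its ends
  in the prescribed order.\<close>

lemma cycle_edges_open:
  assumes "xs \<noteq> []" "{p, q} \<in> cycle_edges xs"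
  obtains ys where "set ys = set xs" "distinct ys = distinct xs" "ys \<noteq> []"
    "cycle_edges ys = cycle_edges xs" "hd ys = p" "last ys = q"
proof -
  have *: "\<exists>ys. set ys = set xs \<and> distinct ys = distinct xs \<and> ys \<noteq> [] \<and>
      cycle_edges ys = cycle_edges xs \<and> {last ys, hd ys} = {p, q}"
  proof (cases "{p, q} = {last xs, hd xs}")
    case True
    then show ?thesis using assms by blast
  next
    case False
    then have "{p, q} \<in> path_edges xs" using assms by (simp add: cycle_edges_def)
    then obtain ys zs where "xs = ys @ zs" "ys \<noteq> []" "zs \<noteq> []" "{last ys, hd zs} = {p, q}"
      by (metis path_edges_split)
    then have "cycle_edges (zs @ ys) = cycle_edges xs" "{last (zs @ ys), hd (zs @ ys)} = {p, q}"
      by (simp_all add: cycle_edges_append_commute)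
    moreover have "set (zs @ ys) = set xs" "distinct (zs @ ys) = distinct xs" "zs @ ys \<noteq> []"
      using \<open>xs = ys @ zs\<close> \<open>zs \<noteq> []\<close> by auto
    ultimately show ?thesis by (intro exI conjI)
  qed
  then obtain ys where ys: "set ys = set xs" "distinct ys = distinct xs" "ys \<noteq> []"
      "cycle_edges ys = cycle_edges xs" "{last ys, hd ys} = {p, q}"
    by blast
  show ?thesis
  proof (cases "hd ys = p \<and> last ys = q")
    case True
    then show ?thesis using that ys by blast
  next
    case False
    then have "hd (rev ys) = p" "last (rev ys) = q"
      using ys(3,5) by (auto simp: hd_rev last_rev doubleton_eq_iff)
    then show ?thesis using that[of "rev ys"] ys by (simp add: cycle_edges_rev)
  qed
qed

lemma hamiltonianI:
  assumes "\<And>x y. adj x y \<Longrightarrow> adj y x"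
    and "distinct xs" "length xs \<ge> 3" "cycle_edges xs \<subseteq> {{x, y} |x y. adj x y}"
  shows "hamiltonian (set xs) adj"
proof -
  have adj: "adj x y" if "{x, y} \<in> cycle_edges xs" for x y
    using that assms(1,4) by (fastforce simp: doubleton_eq_iff)
  have "adj (xs ! i) (xs ! ((i + 1) mod length xs))" if "i < length xs" for i
  proof (cases "Suc i = length xs")
    case True
    moreover have "xs \<noteq> []" using assms(3) by auto
    ultimately have "xs ! i = last xs" "xs ! ((i + 1) mod length xs) = hd xs"
      by (simp_all add: last_conv_nth hd_conv_nth flip: True)
    then show ?thesis using adj by (simp add: cycle_edges_def)
  next
    case False
    then show ?thesis
      using adj path_edges_nth[of i xs] that by (simp add: cycle_edges_def)
  qed
  then show ?thesis
    unfolding hamiltonian_def using assms(2,3) by blast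
qed

section \<open>Opening, gluing and extending cycles that contain rungs\<close>

text \<open>In the application \<tau> is an involution on actual vertices only. These are exactly
  the points with a neighbour, hence the premise \<open>adj x y\<close> in each law.\<close>

locale rung_graph =
  fixes adj :: "'v \<Rightarrow> 'v \<Rightarrow> bool" and \<tau> :: "'v \<Rightarrow> 'v"
  assumes adj_sym: "adj x y \<Longrightarrow> adj y x"
    and adj_\<tau>: "adj x y \<Longrightarrow> adj (\<tau> x) (\<tau> y)"
    and adj_rung: "adj x y \<Longrightarrow> adj x (\<tau> x)"
    and \<tau>_\<tau>: "adj x y \<Longrightarrow> \<tau> (\<tau> x) = x"
    and \<tau>_neq: "adj x y \<Longrightarrow> \<tau> x \<noteq> x"
begin

definition edges :: "'v set set" where
  "edges = {{x, y} |x y. adj x y}"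

lemma doubleton_in_edges [simp]: "{x, y} \<in> edges \<longleftrightarrow> adj x y"
  unfolding edges_def using adj_sym by (auto simp: doubleton_eq_iff)

abbreviation orbit :: "'v \<Rightarrow> 'v set" where
  "orbit x \<equiv> {x, \<tau> x}"

text \<open>This is what remains of a spanning cycle of \<open>W\<close> when the rung at
  \<open>p\<close> is cut. \<open>P\<close> names rungs known to be present, each by either of its
  ends.\<close>

definition rung_path :: "'v set \<Rightarrow> 'v set \<Rightarrow> 'v \<Rightarrow> bool" where
  "rung_path W P p \<longleftrightarrow> (\<exists>xs. xs \<noteq> [] \<and> distinct xs \<and> set xs = W \<and> hd xs = p \<and> last xs = \<tau> p \<and>
     path_edges xs \<subseteq> edges \<and> orbit ` P \<subseteq> path_edges xs)"

definition rung_cycle :: "'v set \<Rightarrow> 'v set \<Rightarrow> bool" where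
  "rung_cycle W P \<longleftrightarrow> (\<exists>xs. xs \<noteq> [] \<and> distinct xs \<and> set xs = W \<and>
     cycle_edges xs \<subseteq> edges \<and> orbit ` P \<subseteq> cycle_edges xs)"

lemma rung_cycle_mono:
  assumes "rung_cycle W P" "Q \<subseteq> P"
  shows "rung_cycle W Q"
proof -
  obtain xs where xs: "xs \<noteq> []" "distinct xs" "set xs = W" "cycle_edges xs \<subseteq> edges"
      "orbit ` P \<subseteq> cycle_edges xs"
    using assms unfolding rung_cycle_def by (elim exE conjE)
  moreover have "orbit ` Q \<subseteq> cycle_edges xs"
    using image_mono[OF assms(2)] xs(5) by (rule subset_trans)
  ultimately show ?thesis unfolding rung_cycle_def by (intro exI conjI)
qed

lemma rung_cycle_subset:
  assumes "rung_cycle W P"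
  shows "P \<subseteq> W"
proof
  fix p assume "p \<in> P"
  then obtain xs where "xs \<noteq> []" "set xs = W" "orbit p \<in> cycle_edges xs"
    using assms unfolding rung_cycle_def by auto
  then show "p \<in> W" using cycle_edges_subset[of xs "orbit p"] by simp
qed

text \<open>The rung at \<open>p\<close> is turned into the closing edge and cut. Both of its ends
  name the same edge, so all of \<open>orbit p\<close> leaves \<open>P\<close>.\<close>

lemma rung_cycle_open:
  assumes "rung_cycle W P" "p \<in> P"
  shows "rung_path W (P - orbit p) p"
proof -
  obtain xs where xs: "xs \<noteq> []" "distinct xs" "set xs = W" "cycle_edges xs \<subseteq> edges"
      "orbit ` P \<subseteq> cycle_edges xs"
    using assms unfolding rung_cycle_def by blast
  have "orbit p \<in> cycle_edges xs" using xs(5) assms(2) by blast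
  then obtain ys where ys: "set ys = set xs" "distinct ys = distinct xs" "ys \<noteq> []"
      "cycle_edges ys = cycle_edges xs" "hd ys = p" "last ys = \<tau> p"
    using cycle_edges_open[OF xs(1)] by metis
  have *: "cycle_edges ys = insert (orbit p) (path_edges ys)"
    unfolding cycle_edges_def ys(5,6) by (simp add: insert_commute)
  have "orbit q \<in> path_edges ys" if "q \<in> P - orbit p" for q
  proof -
    have "orbit q \<in> cycle_edges ys" "orbit q \<noteq> orbit p" using that xs(5) ys(4) by auto
    then show ?thesis by (simp only: * insert_iff simp_thms)
  qed
  then have "orbit ` (P - orbit p) \<subseteq> path_edges ys" by (rule image_subsetI)
  moreover have "path_edges ys \<subseteq> edges"
    using xs(4) unfolding ys(4)[symmetric] * by simp
  ultimately show ?thesis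
    unfolding rung_path_def using xs(2,3) ys by (intro exI[of _ ys]) simp
qed

text \<open>One path followed by the reverse of the other is closed up by \<open>{p, p'}\<close> and
  its image under \<tau>.\<close>

lemma rung_path_glue:
  assumes "rung_path W P p" "rung_path W' P' p'" "adj p p'" "W \<inter> W' = {}"
  shows "rung_cycle (W \<union> W') (P \<union> P')"
proof -
  obtain xs where xs: "xs \<noteq> []" "distinct xs" "set xs = W" "hd xs = p" "last xs = \<tau> p"
      "path_edges xs \<subseteq> edges" "orbit ` P \<subseteq> path_edges xs"
    using assms(1) unfolding rung_path_def by blast
  obtain ys where ys: "ys \<noteq> []" "distinct ys" "set ys = W'" "hd ys = p'" "last ys = \<tau> p'"
      "path_edges ys \<subseteq> edges" "orbit ` P' \<subseteq> path_edges ys"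
    using assms(2) unfolding rung_path_def by blast
  have edg: "cycle_edges (xs @ rev ys) =
      insert {p', p} (insert {\<tau> p, \<tau> p'} (path_edges xs \<union> path_edges ys))"
    using xs ys by (simp add: cycle_edges_def path_edges_append path_edges_rev hd_rev last_rev)
  have "{p', p} \<in> edges" "{\<tau> p, \<tau> p'} \<in> edges"
    using assms(3) adj_\<tau> adj_sym by auto
  then have "cycle_edges (xs @ rev ys) \<subseteq> edges"
    unfolding edg using xs(6) ys(6) by simp
  moreover have "orbit ` (P \<union> P') \<subseteq> cycle_edges (xs @ rev ys)"
    unfolding edg image_Un using Un_mono[OF xs(7) ys(7)] by (rule subset_insertI2[OF subset_insertI2])
  ultimately show ?thesis
    unfolding rung_cycle_def using xs(1-3) ys(1-3) assms(4)
    by (intro exI[of _ "xs @ rev ys"]) simp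
qed

lemma rung_path_orbit: "adj x y \<Longrightarrow> rung_path (orbit x) {x} x"
  unfolding rung_path_def using \<tau>_neq[of x y] adj_rung[of x y] by (intro exI[of _ "[x, \<tau> x]"]) auto

text \<open>A single rung is a rung path, so gluing replaces the rung at \<open>p\<close> by a
  detour over \<open>x\<close> and \<open>\<tau> x\<close>, whose rung is then available for the
  next extension.\<close>

lemma rung_cycle_extend:
  assumes "rung_cycle W P" "p \<in> P" "adj p x" "x \<notin> W" "\<tau> x \<notin> W"
  shows "rung_cycle (W \<union> orbit x) (P - orbit p \<union> {x})"
  using rung_path_glue[OF rung_cycle_open[OF assms(1,2)] rung_path_orbit] assms adj_sym by blast

text \<open>Each extension uses up the rung gained by the previous one, so among the old rungs only
  that at \<open>f k\<close> is at stake.\<close>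

lemma rung_cycle_extend_path:
  assumes "rung_cycle W P" "f k \<in> P" "k \<le> l"
    and "\<And>i. k \<le> i \<Longrightarrow> i < l \<Longrightarrow> adj (f i) (f (Suc i))"
    and "\<And>i. k < i \<Longrightarrow> i \<le> l \<Longrightarrow> orbit (f i) \<inter> W = {}"
    and "\<And>i j. k < i \<Longrightarrow> i < j \<Longrightarrow> j \<le> l \<Longrightarrow> orbit (f i) \<inter> orbit (f j) = {}"
  shows "rung_cycle (W \<union> (\<Union>i\<in>{k<..l}. orbit (f i))) (P - orbit (f k) \<union> {f l})"
  using assms(3-6)
proof (induction l rule: dec_induct)
  case base
  show ?case by (rule rung_cycle_mono[of _ P]) (use assms(1,2) in auto)
next
  case (step n)
  let ?W = "W \<union> (\<Union>i\<in>{k<..n}. orbit (f i))"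
  have "orbit (f (Suc n)) \<inter> W = {}" using step by simp
  moreover have "orbit (f i) \<inter> orbit (f (Suc n)) = {}" if "i \<in> {k<..n}" for i
    using that step.prems(3)[of i "Suc n"] by simp
  ultimately have "f (Suc n) \<notin> ?W" "\<tau> (f (Suc n)) \<notin> ?W" by blast+
  moreover have "rung_cycle ?W (P - orbit (f k) \<union> {f n})"
    using step by simp
  ultimately have *: "rung_cycle (?W \<union> orbit (f (Suc n)))
      ((P - orbit (f k) \<union> {f n}) - orbit (f n) \<union> {f (Suc n)})"
    by (intro rung_cycle_extend) (use step in auto)
  \<comment> \<open>For \<open>n\<close> other than \<open>k\<close> the rung used up now lies
    outside \<open>W\<close>, so nothing is lost from \<open>P\<close>.\<close>
  have "P \<subseteq> W" using rung_cycle_subset assms(1) .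
  then have "P \<inter> orbit (f n) = {}" if "k \<noteq> n"
    using step.prems(2)[of n] step.hyps that by auto
  then have "P - orbit (f k) \<union> {f (Suc n)} \<subseteq>
      (P - orbit (f k) \<union> {f n}) - orbit (f n) \<union> {f (Suc n)}"
    by (cases "k = n") blast+
  note * = rung_cycle_mono[OF * this]
  have eq: "{k<..Suc n} = insert (Suc n) {k<..n}" using step.hyps by auto
  from * show ?case
    by (simp add: eq Un_commute Un_left_commute del: Un_insert_left Un_insert_right)
qed

section \<open>Lifting a closed walk of even length to a cycle through all its rungs\<close>

text \<open>Rungs are traversed alternately away from the walk and back to it. A single leftover
  vertex is dropped, hence the evenness assumptions below.\<close>

fun zigzag :: "'v list \<Rightarrow> 'v list" where
  "zigzag (x # y # xs) = x # \<tau> x # \<tau> y # y # zigzag xs"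
| "zigzag _ = []"

lemma set_zigzag: "even (length xs) \<Longrightarrow> set (zigzag xs) = \<Union> (orbit ` set xs)"
  by (induction xs rule: zigzag.induct) auto

lemma zigzag_ends: "even (length xs) \<Longrightarrow> xs \<noteq> [] \<Longrightarrow>
    zigzag xs \<noteq> [] \<and> hd (zigzag xs) = hd xs \<and> last (zigzag xs) = last xs"
  by (induction xs rule: zigzag.induct) (auto split: if_splits)

lemma path_edges_zigzag:
  assumes "even (length xs)" "path_edges xs \<subseteq> edges"
  shows "path_edges (zigzag xs) \<subseteq> edges \<and> orbit ` set xs \<subseteq> path_edges (zigzag xs)"
  using assms
proof (induction xs rule: zigzag.induct)
  case (1 x y xs)
  have "adj x y" using 1 by simp
  then have xy: "adj x y" "adj x (\<tau> x)" "adj (\<tau> x) (\<tau> y)" "adj y (\<tau> y)" "adj (\<tau> y) y"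
    using adj_sym adj_rung adj_\<tau> by blast+
  show ?case
  proof (cases "xs = []")
    case True
    then show ?thesis using xy by (auto simp: insert_commute)
  next
    case False
    then have ends: "zigzag xs \<noteq> []" "hd (zigzag xs) = hd xs"
      using zigzag_ends[of xs] 1 by auto
    obtain z zs where z: "xs = z # zs" using False by (cases xs) auto
    have pe: "path_edges (zigzag (x # y # xs)) =
        {orbit x, {\<tau> x, \<tau> y}, {\<tau> y, y}, {y, z}} \<union> path_edges (zigzag xs)"
      using path_edges_append[of "[x, \<tau> x, \<tau> y, y]" "zigzag xs"] ends z by auto
    have yz: "adj y z" and sub: "path_edges xs \<subseteq> edges" using 1 z by auto
    have "even (length xs)" using 1 by simp
    note IH = 1(1)[OF this sub]
    have "path_edges (zigzag (x # y # xs)) \<subseteq> edges"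
      unfolding pe using xy yz IH by simp
    moreover have "orbit ` set (x # y # xs) = {orbit x, {\<tau> y, y}} \<union> orbit ` set xs"
      by (simp add: insert_commute)
    then have "orbit ` set (x # y # xs) \<subseteq> path_edges (zigzag (x # y # xs))"
      unfolding pe by (rule ssubst) (intro Un_mono conjunct2[OF IH], simp)
    ultimately show ?thesis ..
  qed
qed auto

lemma cycle_edges_adj:
  assumes "cycle_edges xs \<subseteq> edges" "length xs \<ge> 2" "x \<in> set xs"
  shows "\<exists>y. adj x y"
proof -
  obtain y where "{x, y} \<in> path_edges xs" using path_edges_cover assms(2,3) by metis
  then have "{x, y} \<in> edges" using assms(1) by (auto simp: cycle_edges_def)
  then show ?thesis by auto
qed

text \<open>Passing through both vertices of an orbit swaps the two lifts of a walk, so a closed walk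
  of even length that traverses a rung at each step does close up.\<close>

lemma rung_cycle_zigzag:
  assumes "even (length xs)" "xs \<noteq> []" "cycle_edges xs \<subseteq> edges" "distinct xs"
    and "\<And>x. x \<in> set xs \<Longrightarrow> \<tau> x \<notin> set xs"
  shows "rung_cycle (\<Union> (orbit ` set xs)) (set xs)"
proof -
  have "length xs \<ge> 2" using assms(1,2) by (cases xs rule: zigzag.cases) auto
  note adj = cycle_edges_adj[OF assms(3) this]
  have "distinct (zigzag xs)"
    using assms(1,4,5) adj
  proof (induction xs rule: zigzag.induct)
    case (1 x y xs)
    have inv: "\<tau> (\<tau> z) = z" "\<tau> z \<noteq> z" if "z \<in> set (x # y # xs)" for z
      using 1(5)[OF that] \<tau>_\<tau> \<tau>_neq by blast+
    have IH: "distinct (zigzag xs)"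
      by (rule 1) (use 1(2-) in auto)
    have inj: "\<tau> z \<noteq> \<tau> z'" if "z \<noteq> z'" "z \<in> set (x # y # xs)" "z' \<in> set (x # y # xs)" for z z'
      using inv(1)[OF that(2)] inv(1)[OF that(3)] that(1) by auto
    have "orbit z \<inter> orbit w = {}" if "z = x \<or> z = y" "w \<in> set xs" for z w
    proof -
      have "z \<noteq> w" and mem: "z \<in> set (x # y # xs)" "w \<in> set (x # y # xs)" using that 1(3) by auto
      then show ?thesis using inj[of z w] 1(4)[OF mem(1)] 1(4)[OF mem(2)] mem by fastforce
    qed
    then have "orbit x \<inter> \<Union> (orbit ` set xs) = {}" "orbit y \<inter> \<Union> (orbit ` set xs) = {}"
      by blast+
    moreover have "x \<noteq> \<tau> y" "y \<noteq> \<tau> x" "\<tau> x \<noteq> \<tau> y" "x \<noteq> y"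
      using 1(3) 1(4)[of x] 1(4)[of y] inj[of x y] by auto
    ultimately show ?case
      using IH inv(2)[of x] inv(2)[of y] set_zigzag[of xs] 1(2) by auto
  qed auto
  have "path_edges xs \<subseteq> edges" using assms(3) by (simp add: cycle_edges_def)
  note pe = path_edges_zigzag[OF assms(1) this]
  have ends: "zigzag xs \<noteq> []" "hd (zigzag xs) = hd xs" "last (zigzag xs) = last xs"
    using zigzag_ends assms(1,2) by auto
  have "cycle_edges (zigzag xs) \<subseteq> edges"
    using pe assms(3) unfolding cycle_edges_def ends by simp
  moreover have "orbit ` set xs \<subseteq> cycle_edges (zigzag xs)"
    unfolding cycle_edges_def using pe by (intro subset_insertI2) simp
  ultimately show ?thesis
    unfolding rung_cycle_def
    using ends(1) set_zigzag[OF assms(1)] \<open>distinct (zigzag xs)\<close> by (intro exI conjI)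
qed

lemma rung_cycle_zigzag_sorted:
  assumes "even (length xs)" "xs \<noteq> []" "cycle_edges xs \<subseteq> edges"
    and disj: "sorted_wrt (\<lambda>x y. orbit x \<inter> orbit y = {}) xs"
  shows "rung_cycle (\<Union> (orbit ` set xs)) (set xs)"
proof (rule rung_cycle_zigzag[OF assms(1-3)])
  have disj': "orbit (xs ! i) \<inter> orbit (xs ! j) = {}" if "i \<noteq> j" "i < length xs" "j < length xs" for i j
    using disj that unfolding sorted_wrt_iff_nth_less by (metis inf_commute linorder_neqE_nat)
  then show "distinct xs" unfolding distinct_conv_nth by blast
  show "\<tau> x \<notin> set xs" if x: "x \<in> set xs" for x
  proof
    have "length xs \<ge> 2" using assms(1,2) by (cases xs rule: zigzag.cases) auto
    then have "\<tau> x \<noteq> x" using cycle_edges_adj[OF assms(3) _ x] \<tau>_neq by blast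
    moreover assume "\<tau> x \<in> set xs"
    then obtain j where j: "j < length xs" "xs ! j = \<tau> x" by (auto simp: in_set_conv_nth)
    obtain i where i: "i < length xs" "xs ! i = x" using x by (auto simp: in_set_conv_nth)
    ultimately have "i \<noteq> j" using j by auto
    from disj'[OF this i(1) j(1)] show False unfolding i(2) j(2) by simp
  qed
qed

end

section \<open>Residue classes in a bicirculant\<close>

text \<open>\<open>d div gcd d s\<close> is the order of \<open>s\<close> in the integers modulo
  \<open>d\<close>.\<close>

lemma dvd_mult_iff_div_gcd_dvd:
  fixes d k s :: int
  assumes "d > 0"
  shows "d dvd k * s \<longleftrightarrow> d div gcd d s dvd k"
proof -
  have "gcd d s \<noteq> 0" using assms by auto
  have "d dvd k * s \<longleftrightarrow> gcd d s * (d div gcd d s) dvd gcd d s * (k * (s div gcd d s))"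
    by (simp add: dvd_mult_div_cancel mult.left_commute)
  also have "\<dots> \<longleftrightarrow> d div gcd d s dvd k * (s div gcd d s)"
    using \<open>gcd d s \<noteq> 0\<close> by (rule dvd_times_left_cancel_iff)
  finally have "d dvd k * s \<longleftrightarrow> d div gcd d s dvd k * (s div gcd d s)" .
  moreover have "coprime (d div gcd d s) (s div gcd d s)"
    using assms by (intro div_gcd_coprime) auto
  ultimately show ?thesis by (simp add: coprime_dvd_mult_left_iff)
qed

text \<open>Bezout gives a multiple of \<open>s\<close> congruent to \<open>i\<close>; its factor
  may be reduced modulo the order of \<open>s\<close>.\<close>

lemma ex_multiple_residue:
  fixes d s i :: int
  assumes "d > 0" "gcd d s dvd i"
  shows "\<exists>k < nat (d div gcd d s). d dvd i - int k * s"
proof -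
  let ?t = "d div gcd d s"
  have t: "?t > 0" using assms(1) by (simp add: pos_imp_zdiv_pos_iff zdvd_imp_le)
  obtain u v where uv: "u * d + v * s = gcd d s" using bezout_int by blast
  obtain q where q: "i = gcd d s * q" using assms(2) by (elim dvdE)
  define k where "k = (q * v) mod ?t"
  have "?t dvd q * v - k" unfolding k_def by (simp add: minus_mod_eq_mult_div)
  then have "d dvd (q * v - k) * s" using dvd_mult_iff_div_gcd_dvd[OF assms(1)] by simp
  then have "d dvd (q * v - k) * s + d * (u * q)" by simp
  moreover have "(q * v - k) * s + d * (u * q) = i - k * s"
    unfolding q uv[symmetric] by (simp add: algebra_simps)
  ultimately have "d dvd i - k * s" by simp
  moreover have "0 \<le> k" "k < ?t" using t by (simp_all add: k_def)
  ultimately show ?thesis by (intro exI[of _ "nat k"]) auto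
qed

section \<open>The bicirculant with translation by \<open>m div 2\<close> as a rung graph\<close>

locale bicirculant =
  fixes m :: nat and R S T :: "nat set"
  assumes RT_less: "R \<subseteq> {..<m}" "T \<subseteq> {..<m}"
    and symm: "symm_mod m R" "symm_mod m T"
    and even_m: "even m" and m_pos: "m > 0"
    and half_mem: "m div 2 \<in> R" "m div 2 \<in> T"
    and zero_mem: "0 \<in> S"
begin

definition n :: int where "n = int (m div 2)"

abbreviation "adj \<equiv> bic_adj m R S T"

text \<open>Indices are arbitrary integers, reduced only here, so that subtraction and integer
  divisibility are available.\<close>

definition vtx :: "bool \<Rightarrow> int \<Rightarrow> bool \<times> nat" where
  "vtx b i = (b, nat (i mod int m))"

definition shift :: "bool \<times> nat \<Rightarrow> bool \<times> nat" where
  "shift x = (fst x, (snd x + m div 2) mod m)"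

lemma int_m: "int m = 2 * n"
  unfolding n_def using even_m by (metis dvd_mult_div_cancel of_nat_mult of_nat_numeral)

lemma n_pos: "n > 0"
  using int_m m_pos by linarith

lemma vtx_eq_iff: "vtx b i = vtx b' j \<longleftrightarrow> b = b' \<and> int m dvd i - j"
  unfolding vtx_def using m_pos by (simp add: nat_eq_iff mod_eq_dvd_iff)

lemma vtx_add_mod: "vtx b (i + int j) = (b, (nat (i mod int m) + j) mod m)"
proof -
  have "int ((nat (i mod int m) + j) mod m) = (i + int j) mod int m"
    using m_pos by (simp add: zmod_int mod_simps)
  then show ?thesis unfolding vtx_def by (metis nat_int)
qed

lemma vtx_of_pair: "snd x < m \<Longrightarrow> x = vtx (fst x) (int (snd x))"
  unfolding vtx_def by (cases x) simp

lemma shift_vtx: "shift (vtx b i) = vtx b (i + n)"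
  unfolding n_def vtx_add_mod by (simp add: shift_def vtx_def)

lemma adj_R: "j \<in> R \<Longrightarrow> adj (vtx False i) (vtx False (i + int j))"
  and adj_S: "j \<in> S \<Longrightarrow> adj (vtx False i) (vtx True (i + int j))"
  and adj_T: "j \<in> T \<Longrightarrow> adj (vtx True i) (vtx True (i + int j))"
  unfolding vtx_add_mod using m_pos by (auto simp: bic_adj_def vtx_def nat_less_iff)

text \<open>The negative of \<open>j\<close> is the step back; this makes adjacency
  symmetric.\<close>

lemma symm_mod_step:
  assumes "symm_mod m A" "A \<subseteq> {..<m}" "j \<in> A" "x < m"
  shows "\<exists>k\<in>A. x = ((x + j) mod m + k) mod m"
proof -
  have "(m - j) mod m \<in> A" using assms unfolding symm_mod_def by blast
  moreover have "j < m" using assms by auto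
  then have "((x + j) mod m + (m - j) mod m) mod m = (x + m) mod m"
    unfolding mod_add_eq by (intro arg_cong2[of _ _ _ _ "(mod)"]) auto
  ultimately show ?thesis using assms(4) by (metis mod_add_self2 mod_less)
qed

lemma double_half: "m div 2 + m div 2 = m"
  using even_m by presburger

sublocale rung_graph adj shift
proof
  fix x y assume xy: "adj x y"
  then have lt: "snd x < m" "snd y < m" by (auto simp: bic_adj_def)
  show "adj y x"
    using xy symm_mod_step[OF symm(1) RT_less(1)] symm_mod_step[OF symm(2) RT_less(2)]
    unfolding bic_adj_def by metis
  have *: "((a + j) mod m + m div 2) mod m = ((a + m div 2) mod m + j) mod m" for a j
    by (simp add: mod_simps ac_simps)
  show "adj (shift x) (shift y)"
    using xy m_pos unfolding bic_adj_def shift_def by (auto simp: *)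
  show "adj x (shift x)"
    using lt half_mem unfolding bic_adj_def shift_def by auto
  have "((snd x + m div 2) mod m + m div 2) mod m = (snd x + (m div 2 + m div 2)) mod m"
    by (simp only: mod_add_left_eq add.assoc)
  then show "shift (shift x) = x"
    unfolding shift_def double_half using lt by (cases x) simp
  have "(snd x + m div 2) mod m \<noteq> snd x"
  proof (cases "snd x + m div 2 < m")
    case True
    then show ?thesis using double_half m_pos by simp
  next
    case False
    then have "(snd x + m div 2) mod m = snd x + m div 2 - m"
      using lt double_half by (subst mod_if) auto
    then show ?thesis using double_half m_pos False by linarith
  qed
  then show "shift x \<noteq> x" by (cases x) (auto simp: shift_def)
qed

text \<open>Since \<open>m\<close> is twice \<open>n\<close>, the multiples of \<open>n\<close> are
  \<open>0\<close> and \<open>n\<close> modulo \<open>m\<close>. Orbits of \<open>shift\<close> are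
  therefore residues modulo \<open>n\<close> on one side.\<close>

lemma n_dvd_iff: "n dvd k \<longleftrightarrow> int m dvd k \<or> int m dvd k - n"
proof
  assume "n dvd k"
  then obtain q where q: "k = n * q" by (elim dvdE)
  show "int m dvd k \<or> int m dvd k - n"
  proof (cases "even q")
    case True
    then show ?thesis unfolding q int_m by (auto elim!: evenE)
  next
    case False
    then obtain p where "q = 2 * p + 1" by (elim oddE)
    then have "k - n = int m * p" unfolding q int_m by (simp add: algebra_simps)
    then show ?thesis by simp
  qed
next
  assume "int m dvd k \<or> int m dvd k - n"
  then have "n dvd k \<or> n dvd k - n" unfolding int_m by (metis dvd_mult_right)
  then show "n dvd k" by (metis diff_add_cancel dvd_add dvd_refl)
qed

lemma vtx_in_orbit_iff: "vtx b i \<in> orbit (vtx b' j) \<longleftrightarrow> b = b' \<and> n dvd i - j"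
  unfolding n_dvd_iff[of "i - j"] by (auto simp: shift_vtx vtx_eq_iff algebra_simps)

lemma orbit_vtx_eq: "orbit (vtx b i) = {vtx b j |j. n dvd j - i}"
proof (intro subset_antisym subsetI)
  fix x assume "x \<in> orbit (vtx b i)"
  then consider "x = vtx b i" | "x = vtx b (i + n)" by (auto simp: shift_vtx)
  then show "x \<in> {vtx b j |j. n dvd j - i}" by cases auto
next
  fix x assume "x \<in> {vtx b j |j. n dvd j - i}"
  then obtain j where "x = vtx b j" "n dvd j - i" by blast
  then show "x \<in> orbit (vtx b i)" by (simp only: vtx_in_orbit_iff simp_thms)
qed

lemma dvd_n_dvd_m: "d dvd n \<Longrightarrow> int m dvd k \<Longrightarrow> d dvd k"
  unfolding int_m by (metis dvd_mult_right dvd_trans)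

lemma orbit_vtx_disjoint_iff:
  "orbit (vtx b i) \<inter> orbit (vtx b' j) = {} \<longleftrightarrow> \<not> (b = b' \<and> n dvd i - j)"
proof
  assume "orbit (vtx b i) \<inter> orbit (vtx b' j) = {}"
  then have "vtx b i \<notin> orbit (vtx b' j)" by blast
  then show "\<not> (b = b' \<and> n dvd i - j)" by (simp only: vtx_in_orbit_iff not_False_eq_True)
next
  assume *: "\<not> (b = b' \<and> n dvd i - j)"
  have False if "x \<in> orbit (vtx b i)" "x \<in> orbit (vtx b' j)" for x
  proof -
    obtain k k' where k: "x = vtx b k" "n dvd k - i" "x = vtx b' k'" "n dvd k' - j"
      using \<open>x \<in> orbit (vtx b i)\<close> \<open>x \<in> orbit (vtx b' j)\<close> unfolding orbit_vtx_eq by blast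
    then have "vtx b k = vtx b' k'" by simp
    then have "b = b'" "int m dvd k - k'" by (simp_all add: vtx_eq_iff)
    moreover have "n dvd (k - k') - (k - i) + (k' - j)"
      by (rule dvd_add[OF dvd_diff[OF dvd_n_dvd_m[OF dvd_refl \<open>int m dvd k - k'\<close>] k(2)] k(4)])
    ultimately show False using * by simp
  qed
  then show "orbit (vtx b i) \<inter> orbit (vtx b' j) = {}" by blast
qed

section \<open>Residue classes modulo a divisor of \<open>n\<close>, and chains of cycles on
  them\<close>

definition cls :: "int \<Rightarrow> int \<Rightarrow> (bool \<times> nat) set" where
  "cls d c = {vtx b i |b i. d dvd i - c}"

lemma vtx_in_cls_iff:
  assumes "d dvd n"
  shows "vtx b i \<in> cls d c \<longleftrightarrow> d dvd i - c"
proof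
  assume "vtx b i \<in> cls d c"
  then obtain j where "int m dvd i - j" "d dvd j - c" unfolding cls_def by (auto simp: vtx_eq_iff)
  then have "d dvd (i - j) + (j - c)" using dvd_n_dvd_m[OF assms] by (intro dvd_add)
  then show "d dvd i - c" by simp
qed (auto simp: cls_def)

lemma cls_cases:
  assumes "x \<in> cls d c"
  obtains b i where "x = vtx b i" "d dvd i - c"
  using assms unfolding cls_def by blast

lemma cls_cong: "d dvd c - c' \<Longrightarrow> cls d c = cls d c'"
  unfolding cls_def using dvd_diff_right_iff[of d "c - c'"] dvd_add_right_iff[of d "c - c'"]
  by (metis (no_types, opaque_lifting) diff_add_cancel diff_diff_eq2 add_diff_eq)

lemma cls_disjoint:
  assumes "d dvd n" "\<not> d dvd c - c'"
  shows "cls d c \<inter> cls d c' = {}"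
proof -
  have "d dvd c - c'" if "d dvd i - c" "d dvd i - c'" for i
    using dvd_diff[OF that(2,1)] by simp
  then have "x \<notin> cls d c'" if "x \<in> cls d c" for x
    using that assms by (auto simp: vtx_in_cls_iff elim!: cls_cases[of x d c])
  then show ?thesis by blast
qed

lemma orbit_subset_cls:
  assumes "d dvd n" "d dvd i - c"
  shows "orbit (vtx b i) \<subseteq> cls d c"
proof -
  have "d dvd (i - c) + n" using assms by (intro dvd_add)
  then show ?thesis using assms by (simp add: shift_vtx vtx_in_cls_iff algebra_simps)
qed

text \<open>The cycles on the classes of \<open>c, c + s, c + 2s, \<dots>\<close> are joined one after the other. The base
  point moves by \<open>s + i - i'\<close> instead of \<open>s\<close> so that the rung at \<open>(b, i)\<close> of each cycle meets the
  rung at \<open>(b', i')\<close> of the next one.\<close>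

lemma rung_cycle_chain:
  assumes d: "d dvd n" "d dvd i" "d dvd i'"
    and cycles: "\<And>c. rung_cycle (cls d c) {vtx b (c + i), vtx b' (c + i')}"
    and ne: "\<not> (b = b' \<and> n dvd i - i')"
    and link: "\<And>x. adj (vtx b x) (vtx b' (x + s))"
    and W: "rung_cycle W P" "vtx b (c + i) \<in> P"
    and disj: "\<And>k. 1 \<le> k \<Longrightarrow> k \<le> j \<Longrightarrow> cls d (c + int k * s) \<inter> W = {}"
    and ndvd: "\<And>k. 1 \<le> k \<Longrightarrow> k \<le> j \<Longrightarrow> \<not> d dvd int k * s"
  shows "rung_cycle (W \<union> (\<Union>k\<in>{1..j}. cls d (c + int k * s)))
    (P - orbit (vtx b (c + i)) \<union> {vtx b (c + i + int j * (s + i - i'))})"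
  using disj ndvd
proof (induction j)
  case 0
  have "P - orbit (vtx b (c + i)) \<union> {vtx b (c + i)} \<subseteq> P" using W(2) by blast
  from rung_cycle_mono[OF W(1) this] show ?case by simp
next
  case (Suc j)
  define \<delta> where "\<delta> = s + i - i'"
  define c' where "c' = c + int (Suc j) * \<delta>"
  define W' where "W' = W \<union> (\<Union>k\<in>{1..j}. cls d (c + int k * s))"
  define P' where "P' = P - orbit (vtx b (c + i))"
  let ?x = "vtx b (c + i + int j * \<delta>)"
  have IH: "rung_cycle W' (P' \<union> {?x})"
    unfolding W'_def P'_def \<delta>_def using Suc by simp
  have cls_eq: "cls d (c + int k * \<delta>) = cls d (c + int k * s)" for k
    by (rule cls_cong) (simp add: \<delta>_def algebra_simps d dvd_diff flip: right_diff_distrib)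
  have cls': "cls d c' = cls d (c + int (Suc j) * s)" unfolding c'_def by (rule cls_eq)
  \<comment> \<open>At the start this orbit has just been removed from \<open>P\<close>; later it
    lies in a class disjoint from \<open>W\<close>.\<close>
  have "P' \<inter> orbit ?x = {}"
  proof (cases "j = 0")
    case True
    then show ?thesis unfolding P'_def by auto
  next
    case False
    have "orbit ?x \<subseteq> cls d (c + int j * \<delta>)"
      by (rule orbit_subset_cls) (use d in auto)
    moreover have "cls d (c + int j * s) \<inter> W = {}" using Suc.prems(1)[of j] False by simp
    moreover have "P \<subseteq> W" by (rule rung_cycle_subset[OF W(1)])
    ultimately show ?thesis unfolding P'_def cls_eq by blast
  qed
  then have P': "P' \<subseteq> (P' \<union> {?x}) - orbit ?x" by blast
  have "cls d (c + int k * s) \<inter> cls d (c + int (Suc j) * s) = {}" if "k \<in> {1..j}" for k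
  proof (rule cls_disjoint[OF d(1)])
    have "\<not> d dvd int (Suc j - k) * s" by (rule Suc.prems(2)) (use that in auto)
    moreover have "int (Suc j - k) * s = - ((c + int k * s) - (c + int (Suc j) * s))"
      using that by (simp add: of_nat_diff algebra_simps)
    ultimately show "\<not> d dvd (c + int k * s) - (c + int (Suc j) * s)" by (metis dvd_minus_iff)
  qed
  moreover have "cls d (c + int (Suc j) * s) \<inter> W = {}" using Suc.prems(1)[of "Suc j"] by simp
  ultimately have disj': "W' \<inter> cls d c' = {}" unfolding W'_def cls' by blast
  \<comment> \<open>The rung by which the new cycle is entered differs from the one kept for leaving
    it.\<close>
  have "vtx b (c' + i) \<notin> orbit (vtx b' (c' + i'))"
    unfolding vtx_in_orbit_iff using ne by simp
  then have Q: "{vtx b (c' + i)} \<subseteq> {vtx b (c' + i), vtx b' (c' + i')} - orbit (vtx b' (c' + i'))"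
    by simp
  have "c' + i' = (c + i + int j * \<delta>) + s" unfolding c'_def \<delta>_def by (simp add: algebra_simps)
  then have adj: "adj ?x (vtx b' (c' + i'))" using link by simp
  have "rung_cycle (W' \<union> cls d c') (((P' \<union> {?x}) - orbit ?x) \<union>
      ({vtx b (c' + i), vtx b' (c' + i')} - orbit (vtx b' (c' + i'))))"
    by (rule rung_path_glue[OF rung_cycle_open[OF IH] rung_cycle_open[OF cycles] adj disj']) simp_all
  then have *: "rung_cycle (W' \<union> cls d c') (P' \<union> {vtx b (c' + i)})"
    by (rule rung_cycle_mono) (use P' Q in \<open>intro Un_mono\<close>)
  have "W' \<union> cls d c' = W \<union> (\<Union>k\<in>{1..Suc j}. cls d (c + int k * s))"
    unfolding W'_def cls' by (simp add: atLeastAtMostSuc_conv Un_ac)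
  moreover have "c' + i = c + i + int (Suc j) * (s + i - i')"
    unfolding c'_def \<delta>_def by simp
  ultimately show ?case using * unfolding P'_def by (simp only:)
qed

lemma class_count_pos: "d > 0 \<Longrightarrow> d div gcd d s > 0" for d s :: int
  by (simp add: pos_imp_zdiv_pos_iff zdvd_imp_le)

lemma cls_gcd:
  assumes "d > 0" "d dvd n"
  shows "cls (gcd d s) c = (\<Union>k < nat (d div gcd d s). cls d (c + int k * s))"
proof (intro subset_antisym subsetI)
  fix x assume "x \<in> cls (gcd d s) c"
  then obtain b i where x: "x = vtx b i" "gcd d s dvd i - c" by (rule cls_cases)
  then obtain k where "k < nat (d div gcd d s)" "d dvd i - c - int k * s"
    using ex_multiple_residue[OF assms(1)] by blast
  then show "x \<in> (\<Union>k < nat (d div gcd d s). cls d (c + int k * s))"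
    unfolding x(1) using assms(2) by (auto simp: vtx_in_cls_iff diff_diff_eq)
next
  fix x assume "x \<in> (\<Union>k < nat (d div gcd d s). cls d (c + int k * s))"
  then obtain b i k where x: "x = vtx b i" "d dvd i - (c + int k * s)"
    by (auto elim: cls_cases)
  have "gcd d s dvd (i - (c + int k * s)) + int k * s"
    using dvd_trans[OF gcd_dvd1 x(2)] by (intro dvd_add) auto
  then show "x \<in> cls (gcd d s) c" unfolding x cls_def by auto
qed

lemma not_dvd_multiple:
  fixes d s :: int
  assumes "d > 0" "1 \<le> k" "int k < d div gcd d s"
  shows "\<not> d dvd int k * s"
  unfolding dvd_mult_iff_div_gcd_dvd[OF assms(1)] using assms by (auto dest: zdvd_imp_le)

text \<open>The chain visits all classes modulo \<open>d\<close> inside one class modulo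
  \<open>gcd d s\<close>. The alternative for \<delta> prevents the displaced rung from meeting
  another one whose offset is divisible by \<open>d\<close>.\<close>

lemma rung_cycle_chain_class:
  assumes d: "d > 0" "d dvd n" "d dvd i" "d dvd i'"
    and cycles: "\<And>c. rung_cycle (cls d c) (P c)"
    and P: "\<And>c. vtx b (c + i) \<in> P c" "\<And>c. vtx b' (c + i') \<in> P c"
    and ne: "\<not> (b = b' \<and> n dvd i - i')"
    and link: "\<And>x. adj (vtx b x) (vtx b' (x + s))"
  shows "\<exists>\<delta>. gcd d s dvd \<delta> \<and> (\<delta> = 0 \<or> \<not> d dvd \<delta>) \<and>
    (\<forall>c. rung_cycle (cls (gcd d s) c) (P c - orbit (vtx b (c + i)) \<union> {vtx b (c + i + \<delta>)}))"
proof -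
  let ?t = "nat (d div gcd d s)"
  \<comment> \<open>There is one link fewer than there are classes; if \<open>d\<close> divides
    \<open>s\<close>, there is none and \<delta> is \<open>0\<close>.\<close>
  let ?j = "?t - 1"
  let ?\<delta> = "int ?j * (s + i - i')"
  have t: "?t \<ge> 1" using class_count_pos[OF d(1), of s] by simp
  have nd: "\<not> d dvd int k * s" if "1 \<le> k" "k \<le> ?j" for k
    using not_dvd_multiple[OF d(1) that(1), of s] that t by linarith
  have eq: "cls d c \<union> (\<Union>k\<in>{1..?j}. cls d (c + int k * s)) = cls (gcd d s) c" for c
  proof -
    have "{..<?t} = insert 0 {1..?j}" using t by auto
    then show ?thesis unfolding cls_gcd[OF d(1,2)] by simp
  qed
  have "rung_cycle (cls (gcd d s) c) (P c - orbit (vtx b (c + i)) \<union> {vtx b (c + i + ?\<delta>)})" for c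
    unfolding eq[symmetric]
  proof (rule rung_cycle_chain[OF d(2-4) _ ne link cycles P(1)])
    show "rung_cycle (cls d c) {vtx b (c + i), vtx b' (c + i')}" for c
      by (rule rung_cycle_mono[OF cycles]) (use P in auto)
    show "cls d (c + int k * s) \<inter> cls d c = {}" if "1 \<le> k" "k \<le> ?j" for k
      by (rule cls_disjoint[OF d(2)]) (use nd[OF that] in simp)
  qed (rule nd)
  moreover have "gcd d s dvd ?\<delta>"
    using dvd_trans[OF gcd_dvd1 d(3)] dvd_trans[OF gcd_dvd1 d(4)]
    by (intro dvd_mult dvd_diff dvd_add) auto
  \<comment> \<open>Modulo \<open>d\<close> the displacement is \<open>?j * s\<close>, and a
    positive \<open>?j\<close> is below the order of \<open>s\<close>.\<close>
  moreover have "\<not> d dvd ?\<delta>" if "?\<delta> \<noteq> 0"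
  proof
    assume "d dvd ?\<delta>"
    then have "d dvd ?\<delta> - int ?j * (i - i')"
      using dvd_mult[OF dvd_diff[OF d(3,4)]] by (rule dvd_diff)
    moreover have "?\<delta> - int ?j * (i - i') = int ?j * s" by (simp add: algebra_simps)
    moreover have "?j \<ge> 1" using that by (cases ?j) auto
    ultimately show False using nd[of ?j] by simp
  qed
  ultimately show ?thesis by blast
qed

section \<open>Good divisors and their stability under gcd\<close>

text \<open>A link of type \<open>R\<close> enters a cycle by one \<open>u\<close> rung and leaves
  it by another, and one of type \<open>T\<close> does so on the \<open>v\<close> side; hence two
  rungs on each side. The offsets do not depend on \<open>c\<close>, so one step links every cycle
  to the next.\<close>

definition good :: "int \<Rightarrow> bool" where
  "good d \<longleftrightarrow> d > 0 \<and> d dvd n \<and> (\<exists>e e' f f'. d dvd e \<and> d dvd e' \<and> d dvd f \<and> d dvd f' \<and>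
     \<not> n dvd e - e' \<and> \<not> n dvd f - f' \<and>
     (\<forall>c. rung_cycle (cls d c)
       {vtx False (c + e), vtx False (c + e'), vtx True (c + f), vtx True (c + f')}))"

text \<open>Links use the offsets \<open>e\<close>, \<open>e'\<close> for \<open>R\<close>,
  \<open>e\<close>, \<open>f\<close> for \<open>S\<close> and \<open>f\<close>, \<open>f'\<close>
  for \<open>T\<close>. Only the first of the two is displaced by the chain; the other three offsets
  persist.\<close>

lemma good_gcd:
  assumes "good d" "s \<in> R \<union> S \<union> T"
  shows "good (gcd d (int s))"
proof -
  define g where "g = gcd d (int s)"
  define P where "P e e' f f' c =
    {vtx False (c + e), vtx False (c + e'), vtx True (c + f), vtx True (c + f')}" for e e' f f' c
  obtain e e' f f' where d: "d > 0" "d dvd n" and dvd: "d dvd e" "d dvd e'" "d dvd f" "d dvd f'"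
    and ne: "\<not> n dvd e - e'" "\<not> n dvd f - f'" and cyc: "\<And>c. rung_cycle (cls d c) (P e e' f f' c)"
    using assms(1) unfolding good_def P_def by blast
  have gd: "g dvd d" "g > 0" "g dvd n" using d dvd_trans[OF gcd_dvd1 d(2)] by (auto simp: g_def)
  have g: "g dvd e" "g dvd e'" "g dvd f" "g dvd f'" using dvd gd(1) dvd_trans by blast+
  have goodI: "good g" if "g dvd x" "g dvd y" "\<not> n dvd x - e'" "\<not> n dvd y - f'"
      "\<And>c. rung_cycle (cls g c) (P x e' y f' c)" for x y
    unfolding good_def using gd that g unfolding P_def by blast
  \<comment> \<open>If the displaced offset agreed with \<open>x'\<close> modulo \<open>n\<close>,
    then \<open>d\<close> would divide \<delta>, so \<delta> would be \<open>0\<close>.\<close>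
  have shifted: "g dvd x + \<delta>" "\<not> n dvd x + \<delta> - x'"
    if "g dvd \<delta>" "\<delta> = 0 \<or> \<not> d dvd \<delta>" "d dvd x" "d dvd x'" "\<not> n dvd x - x'" for x x' \<delta>
  proof -
    show "g dvd x + \<delta>" by (rule dvd_add[OF dvd_trans[OF gd(1) that(3)] that(1)])
    show "\<not> n dvd x + \<delta> - x'"
    proof
      assume *: "n dvd x + \<delta> - x'"
      have "d dvd (x + \<delta> - x') - (x - x')"
        by (rule dvd_diff[OF dvd_trans[OF d(2) *] dvd_diff[OF that(3,4)]])
      then have "\<delta> = 0" using that(2) by simp
      then show False using * that(5) by simp
    qed
  qed
  have "\<not> n dvd e' - e" "\<not> n dvd f' - f" using ne by (metis dvd_minus_iff minus_diff_eq)+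
  then have notin: "vtx False (c + e') \<notin> orbit (vtx False (c + e))" "vtx True i \<notin> orbit (vtx False (c + e))"
      "vtx True (c + f') \<notin> orbit (vtx True (c + f))" "vtx False i \<notin> orbit (vtx True (c + f))" for c i
    unfolding vtx_in_orbit_iff by simp_all
  have keepU: "P (e + \<delta>) e' f f' c \<subseteq> P e e' f f' c - orbit (vtx False (c + e)) \<union> {vtx False (c + e + \<delta>)}"
    and keepV: "P e e' (f + \<delta>) f' c \<subseteq> P e e' f f' c - orbit (vtx True (c + f)) \<union> {vtx True (c + f + \<delta>)}"
    for \<delta> c
    unfolding P_def using notin by (simp_all add: add.assoc)
  consider "s \<in> R" | "s \<in> S" | "s \<in> T" using assms(2) by blast
  then have "good g"
  proof cases
    case 1
    obtain \<delta> where \<delta>: "g dvd \<delta>" "\<delta> = 0 \<or> \<not> d dvd \<delta>" "\<And>c. rung_cycle (cls g c)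
        (P e e' f f' c - orbit (vtx False (c + e)) \<union> {vtx False (c + e + \<delta>)})"
      using rung_cycle_chain_class[OF d dvd(1,2) cyc, where b = False and b' = False and s = "int s"]
        ne(1) adj_R[OF 1] unfolding g_def[symmetric] P_def by auto
    show ?thesis
    proof (rule goodI[of "e + \<delta>" "f"])
      show "rung_cycle (cls g c) (P (e + \<delta>) e' (f) f' c)" for c
        by (rule rung_cycle_mono[OF \<delta>(3)]) (rule keepU)
    qed (use shifted[OF \<delta>(1,2) dvd(1,2) ne(1)] g ne in simp_all)
  next
    case 2
    obtain \<delta> where \<delta>: "g dvd \<delta>" "\<delta> = 0 \<or> \<not> d dvd \<delta>" "\<And>c. rung_cycle (cls g c)
        (P e e' f f' c - orbit (vtx False (c + e)) \<union> {vtx False (c + e + \<delta>)})"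
      using rung_cycle_chain_class[OF d dvd(1,3) cyc, where b = False and b' = True and s = "int s"]
        adj_S[OF 2] unfolding g_def[symmetric] P_def by auto
    show ?thesis
    proof (rule goodI[of "e + \<delta>" "f"])
      show "rung_cycle (cls g c) (P (e + \<delta>) e' (f) f' c)" for c
        by (rule rung_cycle_mono[OF \<delta>(3)]) (rule keepU)
    qed (use shifted[OF \<delta>(1,2) dvd(1,2) ne(1)] g ne in simp_all)
  next
    case 3
    obtain \<delta> where \<delta>: "g dvd \<delta>" "\<delta> = 0 \<or> \<not> d dvd \<delta>" "\<And>c. rung_cycle (cls g c)
        (P e e' f f' c - orbit (vtx True (c + f)) \<union> {vtx True (c + f + \<delta>)})"
      using rung_cycle_chain_class[OF d dvd(3,4) cyc, where b = True and b' = True and s = "int s"]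
        ne(2) adj_T[OF 3] unfolding g_def[symmetric] P_def by auto
    show ?thesis
    proof (rule goodI[of "e" "f + \<delta>"])
      show "rung_cycle (cls g c) (P (e) e' (f + \<delta>) f' c)" for c
        by (rule rung_cycle_mono[OF \<delta>(3)]) (rule keepV)
    qed (use shifted[OF \<delta>(1,2) dvd(3,4) ne(2)] g ne in simp_all)
  qed
  then show ?thesis unfolding g_def .
qed

section \<open>A first good divisor\<close>

lemma orbit_vtx_cong: "n dvd i - j \<Longrightarrow> orbit (vtx b i) = orbit (vtx b j)"
proof -
  assume "n dvd i - j"
  then have "n dvd k - i \<longleftrightarrow> n dvd k - j" for k
    using dvd_add_left_iff[of n "i - j" "k - i"] by simp
  then show ?thesis unfolding orbit_vtx_eq by simp
qed

text \<open>The walk \<open>v_c, u_c, v_(c+a), u_(c+a), ...\<close>, with the \<open>v\<close> side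
  at even positions.\<close>

definition walk :: "int \<Rightarrow> int \<Rightarrow> nat \<Rightarrow> bool \<times> nat" where
  "walk a c k = vtx (even k) (c + int (k div 2) * a)"

text \<open>The order of \<open>a\<close> modulo \<open>n\<close>; the walk is back in its first
  orbit after twice as many steps.\<close>

definition period :: "int \<Rightarrow> nat" where
  "period a = nat (n div gcd n a)"

lemma int_period: "int (period a) = n div gcd n a"
  unfolding period_def using class_count_pos[OF n_pos, of a] by simp

lemma period_dvd_iff: "n dvd k * a \<longleftrightarrow> int (period a) dvd k"
  unfolding int_period by (rule dvd_mult_iff_div_gcd_dvd[OF n_pos])

lemma period_ge_2: "\<not> n dvd a \<Longrightarrow> period a \<ge> 2"
proof -
  assume "\<not> n dvd a"
  then have "\<not> int (period a) dvd 1" using period_dvd_iff[of 1 a] by simp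
  moreover have "period a > 0" using int_period[of a] class_count_pos[OF n_pos, of a] by linarith
  ultimately show ?thesis by (cases "period a = 1") auto
qed

lemma adj_walk: "a \<in> S \<Longrightarrow> adj (walk (int a) c k) (walk (int a) c (Suc k))"
proof (cases "even k")
  case True
  then show ?thesis using adj_sym[OF adj_S[OF zero_mem, of "c + int (k div 2) * int a"]]
    by (simp add: walk_def)
next
  case False
  assume "a \<in> S"
  moreover have "Suc k div 2 = Suc (k div 2)" using False by presburger
  ultimately show ?thesis using False adj_S[of a "c + int (k div 2) * int a"]
    by (simp add: walk_def algebra_simps)
qed

text \<open>Parity decides the side, and on one side two positions share an orbit only if their
  halves differ by a multiple of the period.\<close>

lemma orbit_walk_disjoint:
  assumes "k < k'" "k' < k + 2 * period a"
  shows "orbit (walk a c k) \<inter> orbit (walk a c k') = {}"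
  unfolding walk_def orbit_vtx_disjoint_iff
proof
  assume *: "even k = even k' \<and> n dvd c + int (k div 2) * a - (c + int (k' div 2) * a)"
  then have "n dvd (int (k div 2) - int (k' div 2)) * a" by (simp add: algebra_simps)
  then have dvd: "int (period a) dvd int (k div 2) - int (k' div 2)" unfolding period_dvd_iff .
  have even: "even k = even k'" using * ..
  have "k div 2 < k' div 2" using even assms(1) by presburger
  moreover have "k' div 2 < k div 2 + period a" using even assms(2) by presburger
  ultimately show False using zdvd_imp_le[of "int (period a)" "int (k' div 2) - int (k div 2)"] dvd
    by (simp add: dvd_diff_commute)
qed

lemma orbit_walk_subset: "orbit (walk a c k) \<subseteq> cls (gcd n a) c"
  unfolding walk_def by (rule orbit_subset_cls) auto

text \<open>The window may start anywhere, because closed walks are started on either side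
  below.\<close>

lemma orbits_walk_eq_cls:
  "(\<Union>k\<in>{k0..<k0 + 2 * period a}. orbit (walk a c k)) = cls (gcd n a) c"
proof (intro subset_antisym subsetI)
  fix x assume "x \<in> (\<Union>k\<in>{k0..<k0 + 2 * period a}. orbit (walk a c k))"
  then show "x \<in> cls (gcd n a) c" using orbit_walk_subset by blast
next
  fix x assume "x \<in> cls (gcd n a) c"
  then obtain b i where x: "x = vtx b i" "gcd n a dvd i - c" by (rule cls_cases)
  define k1 where "k1 = (if even k0 = b then k0 else Suc k0)"
  have k1: "even k1 = b" "k0 \<le> k1" "k1 \<le> Suc k0" unfolding k1_def by auto
  have "gcd n a dvd i - c - int (k1 div 2) * a" by (rule dvd_diff[OF x(2) dvd_mult[OF gcd_dvd2]])
  then obtain q where q: "q < period a" "n dvd i - c - int (k1 div 2) * a - int q * a"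
    using ex_multiple_residue[OF n_pos] unfolding period_def by blast
  define k where "k = k1 + 2 * q"
  have "k \<in> {k0..<k0 + 2 * period a}" using k1 q(1) unfolding k_def by auto
  moreover have "even k = b" "k div 2 = k1 div 2 + q" unfolding k_def using k1(1) by auto
  then have "x \<in> orbit (walk a c k)"
    unfolding walk_def x(1) vtx_in_orbit_iff using q(2) by (simp add: algebra_simps)
  ultimately show "x \<in> (\<Union>k\<in>{k0..<k0 + 2 * period a}. orbit (walk a c k))" by blast
qed

section \<open>Cycles grown from a hexagon\<close>

text \<open>The hexagon takes positions \<open>0, 1, 2\<close> of the walk from \<open>c\<close> and
  \<open>1, 2, 3\<close> of the walk from \<open>c - b\<close>, joined by two edges of step
  \<open>b\<close>. Prolonging the arcs costs at most the rungs at the positions \<open>2\<close>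
  and \<open>3\<close> where they are prolonged; the other four and the end of the first arc
  stay.\<close>

lemma rung_cycle_hexagon:
  assumes S: "a \<in> S" "b \<in> S"
    and ne: "\<not> n dvd int a" "\<not> n dvd int b" "\<not> n dvd int a - int b"
    and l: "2 \<le> l" "l < 2 * period (int a)" "3 \<le> l'" "l' \<le> 2 * period (int a)"
    and cross: "\<And>k k'. k \<le> l \<Longrightarrow> 1 \<le> k' \<Longrightarrow> k' \<le> l' \<Longrightarrow>
      orbit (walk (int a) c k) \<inter> orbit (walk (int a) (c - int b) k') = {}"
  shows "rung_cycle ((\<Union>k\<in>{..l}. orbit (walk (int a) c k)) \<union>
      (\<Union>k\<in>{1..l'}. orbit (walk (int a) (c - int b) k)))
    {vtx False c, vtx False (c - int b), vtx True c, vtx True (c - int b + int a), walk (int a) c l}"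
proof -
  define w where "w = walk (int a) c"
  define w' where "w' = walk (int a) (c - int b)"
  define apart where "apart x y \<longleftrightarrow> orbit x \<inter> orbit y = {}" for x y :: "bool \<times> nat"
  have apart_sym: "apart x y \<Longrightarrow> apart y x" for x y unfolding apart_def by blast
  have apart_notin: "apart x y \<Longrightarrow> x \<notin> orbit y" for x y unfolding apart_def by blast
  have D: "apart (w k) (w k')" if "k < k'" "k' \<le> l" for k k'
    unfolding apart_def w_def by (rule orbit_walk_disjoint) (use that l in auto)
  have D': "apart (w' k) (w' k')" if "1 \<le> k" "k < k'" "k' \<le> l'" for k k'
    unfolding apart_def w'_def by (rule orbit_walk_disjoint) (use that l in auto)
  have X: "apart (w k) (w' k')" if "k \<le> l" "1 \<le> k'" "k' \<le> l'" for k k'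
    unfolding apart_def w_def w'_def by (rule cross[OF that])
  have adj_w: "adj (w k) (w (Suc k))" and adj_w': "adj (w' k) (w' (Suc k))" for k
    unfolding w_def w'_def by (rule adj_walk[OF S(1)])+
  have w: "w 0 = vtx True c" "w 1 = vtx False c" "w 2 = vtx True (c + int a)"
    and w': "w' 1 = vtx False (c - int b)" "w' 2 = vtx True (c - int b + int a)"
      "w' 3 = vtx False (c - int b + int a)"
    unfolding w_def w'_def walk_def by simp_all
  define xs where "xs = [w 0, w 1, w 2, w' 3, w' 2, w' 1]"
  have "adj (w 0) (w 1)" "adj (w 1) (w 2)" using adj_w[of 0] adj_w[of 1] by (simp_all add: numeral_2_eq_2)
  moreover have "adj (w' 3) (w' 2)" "adj (w' 2) (w' 1)"
    using adj_sym[OF adj_w'[of 2]] adj_sym[OF adj_w'[of 1]] by (simp_all add: numeral_2_eq_2 numeral_3_eq_3)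
  moreover have "adj (w' 1) (w 0)" unfolding w w' using adj_S[OF S(2), of "c - int b"] by simp
  moreover have "adj (w 2) (w' 3)"
    unfolding w w' using adj_sym[OF adj_S[OF S(2), of "c - int b + int a"]] by (simp add: algebra_simps)
  ultimately have edges: "cycle_edges xs \<subseteq> edges" unfolding xs_def cycle_edges_def by simp
  have "sorted_wrt apart xs"
    unfolding xs_def using l(1,3) by (simp add: D X apart_sym[OF D'])
  then have "sorted_wrt (\<lambda>x y. orbit x \<inter> orbit y = {}) xs" unfolding apart_def .
  from rung_cycle_zigzag_sorted[OF _ _ edges this]
  have hex: "rung_cycle (\<Union> (orbit ` set xs)) (set xs)" by (simp add: xs_def)
  define W where "W = \<Union> (orbit ` set xs)"
  have W: "W = (\<Union>k\<in>{..2}. orbit (w k)) \<union> (\<Union>k\<in>{1..3}. orbit (w' k))"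
  proof -
    have "{..2} = {0, 1, 2::nat}" "{1..3} = {1, 2, 3::nat}" by auto
    then show ?thesis unfolding W_def xs_def by auto
  qed
  have W_disj: "orbit (w k) \<inter> W = {}" if "2 < k" "k \<le> l" for k
  proof -
    have "orbit (w k) \<inter> orbit (w i) = {}" if "i \<in> {..2}" for i
      using apart_sym[OF D, of i k] that \<open>2 < k\<close> \<open>k \<le> l\<close> unfolding apart_def by auto
    moreover have "orbit (w k) \<inter> orbit (w' i) = {}" if "i \<in> {1..3}" for i
      using X[of k i] that l(3) \<open>k \<le> l\<close> unfolding apart_def by auto
    ultimately show ?thesis unfolding W by blast
  qed
  define W1 where "W1 = W \<union> (\<Union>k\<in>{2<..l}. orbit (w k))"
  define P1 where "P1 = set xs - orbit (w 2) \<union> {w l}"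
  have ext: "rung_cycle W1 P1"
    unfolding W1_def P1_def
    by (rule rung_cycle_extend_path[OF hex[folded W_def]])
      (use l(1) adj_w W_disj D in \<open>auto simp: xs_def apart_def\<close>)
  have W1: "W1 = (\<Union>k\<in>{..l}. orbit (w k)) \<union> (\<Union>k\<in>{1..3}. orbit (w' k))"
  proof -
    have "{..l} = {..2} \<union> {2<..l}" using l(1) by auto
    then show ?thesis unfolding W1_def W by blast
  qed
  have W1_disj: "orbit (w' k) \<inter> W1 = {}" if "3 < k" "k \<le> l'" for k
  proof -
    have "orbit (w' k) \<inter> orbit (w' i) = {}" if "i \<in> {1..3}" for i
      using apart_sym[OF D', of i k] that \<open>3 < k\<close> \<open>k \<le> l'\<close> unfolding apart_def by auto
    moreover have "orbit (w' k) \<inter> orbit (w i) = {}" if "i \<in> {..l}" for i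
      using apart_sym[OF X, of i k] that \<open>3 < k\<close> \<open>k \<le> l'\<close> unfolding apart_def by auto
    ultimately show ?thesis unfolding W1 by blast
  qed
  have keep: "{w 0, w 1, w l, w' 1, w' 2, w' 3} \<subseteq> P1"
    unfolding P1_def xs_def using l(1,3)
      apart_notin[OF D[of 0 2]] apart_notin[OF D[of 1 2]] apart_notin[OF apart_sym[OF X[of 2 1]]]
      apart_notin[OF apart_sym[OF X[of 2 2]]] apart_notin[OF apart_sym[OF X[of 2 3]]]
    by (simp del: insert_iff add: insert_subset) (simp add: insert_subset)
  have "rung_cycle (W1 \<union> (\<Union>k\<in>{3<..l'}. orbit (w' k))) (P1 - orbit (w' 3) \<union> {w' l'})"
    by (rule rung_cycle_extend_path[OF ext])
      (use l(3) keep adj_w' W1_disj D' in \<open>auto simp: apart_def\<close>)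
  moreover have "{w 1, w' 1, w 0, w' 2, w l} \<subseteq> P1 - orbit (w' 3) \<union> {w' l'}"
    using keep apart_notin[OF X[of 1 3]] apart_notin[OF X[of 0 3]] apart_notin[OF X[of l 3]]
      apart_notin[OF D'[of 1 3]] apart_notin[OF D'[of 2 3]] l(1,3) by simp
  ultimately have "rung_cycle (W1 \<union> (\<Union>k\<in>{3<..l'}. orbit (w' k))) {w 1, w' 1, w 0, w' 2, w l}"
    by (rule rung_cycle_mono)
  moreover have "W1 \<union> (\<Union>k\<in>{3<..l'}. orbit (w' k)) =
      (\<Union>k\<in>{..l}. orbit (w k)) \<union> (\<Union>k\<in>{1..l'}. orbit (w' k))"
  proof -
    have "{1..l'} = {1..3} \<union> {3<..l'}" using l(3) by auto
    then show ?thesis unfolding W1 by blast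
  qed
  ultimately show ?thesis unfolding w(1,2) w'(1,2) unfolding w_def w'_def by simp
qed

lemma goodI:
  assumes "d > 0" "d dvd n" "d dvd e'" "d dvd f" "d dvd f'" "\<not> n dvd e'" "\<not> n dvd f' - f"
    and "\<And>c. rung_cycle (cls d c) {vtx False c, vtx False (c + e'), vtx True (c + f), vtx True (c + f')}"
  shows "good d"
proof -
  have "\<not> n dvd 0 - e'" "\<not> n dvd f - f'" using assms(6,7) by (simp_all add: dvd_diff_commute)
  then show ?thesis
    unfolding good_def using assms(1-5,8) by (intro conjI exI[of _ 0] exI[of _ e'] exI[of _ f] exI[of _ f']) simp_all
qed

text \<open>Modulo \<open>n\<close>, \<open>- b\<close> is a multiple \<open>q * a\<close>, so up to
  orbits the second walk is the first one shifted by \<open>2 * q\<close> positions, and two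
  complementary arcs fill the class.\<close>

lemma good_hexagon_same_class:
  assumes S: "a \<in> S" "b \<in> S"
    and ne: "\<not> n dvd int a" "\<not> n dvd int b" "\<not> n dvd int a - int b"
    and dvd: "gcd n (int a) dvd int b"
  shows "good (gcd n (int a))"
proof -
  define p where "p = period (int a)"
  have p: "p \<ge> 2" unfolding p_def by (rule period_ge_2[OF ne(1)])
  have "gcd n (int a) dvd - int b" using dvd by simp
  then obtain q where q: "q < p" "n dvd - int b - int q * int a"
    using ex_multiple_residue[OF n_pos] unfolding p_def period_def by blast
  have "q \<noteq> 0" using q(2) ne(2) by (intro notI) simp
  \<comment> \<open>This value would make \<open>a\<close> and \<open>b\<close> congruent modulo
    \<open>n\<close>. Without it and \<open>0\<close>, each arc has room for its three hexagon
    positions.\<close>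
  moreover have "q \<noteq> p - 1"
  proof
    assume "q = p - 1"
    then have eq: "- int b - int q * int a = (int a - int b) - int p * int a"
      using p by (simp add: of_nat_diff algebra_simps)
    have "n dvd int p * int a" unfolding period_dvd_iff p_def by simp
    from dvd_add[OF q(2)[unfolded eq] this] have "n dvd int a - int b" by simp
    then show False using ne(3) by simp
  qed
  ultimately have q': "1 \<le> q" "q + 2 \<le> p" using q(1) p by linarith+
  have shift: "orbit (walk (int a) (c - int b) k) = orbit (walk (int a) c (k + 2 * q))" for c k
    unfolding walk_def using q(2) by (simp add: algebra_simps del: insert_iff) (rule orbit_vtx_cong, simp add: algebra_simps)
  \<comment> \<open>After the shift the second arc covers the positions \<open>2 * q + 1\<close> to
    \<open>2 * p - 1\<close>.\<close>
  let ?l = "2 * q" and ?l' = "2 * p - 1 - 2 * q"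
  have "rung_cycle (cls (gcd n (int a)) c) {vtx False c, vtx False (c + - int b),
      vtx True (c + 0), vtx True (c + (int a - int b))}" for c
  proof -
    have "(\<Union>k\<in>{1..?l'}. orbit (walk (int a) (c - int b) k)) =
        (\<Union>k\<in>(\<lambda>k. k + 2 * q) ` {1..?l'}. orbit (walk (int a) c k))"
      unfolding shift by blast
    also have "(\<lambda>k. k + 2 * q) ` {1..?l'} = {?l + 1..<2 * p}"
      using q' by (subst image_add_atLeastAtMost') auto
    finally have *: "(\<Union>k\<in>{..?l}. orbit (walk (int a) c k)) \<union>
        (\<Union>k\<in>{1..?l'}. orbit (walk (int a) (c - int b) k)) =
        (\<Union>k\<in>{..?l} \<union> {?l + 1..<2 * p}. orbit (walk (int a) c k))" by blast
    also have "{..?l} \<union> {?l + 1..<2 * p} = {0..<0 + 2 * period (int a)}" using q' p_def by auto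
    also have "(\<Union>k\<in>\<dots>. orbit (walk (int a) c k)) = cls (gcd n (int a)) c"
      by (rule orbits_walk_eq_cls)
    finally have union: "(\<Union>k\<in>{..?l}. orbit (walk (int a) c k)) \<union>
        (\<Union>k\<in>{1..?l'}. orbit (walk (int a) (c - int b) k)) = cls (gcd n (int a)) c" .
    have "rung_cycle (cls (gcd n (int a)) c) {vtx False c, vtx False (c - int b), vtx True c,
        vtx True (c - int b + int a), walk (int a) c ?l}"
      unfolding union[symmetric]
    proof (rule rung_cycle_hexagon[OF S ne])
      show "orbit (walk (int a) c k) \<inter> orbit (walk (int a) (c - int b) k') = {}"
        if "k \<le> ?l" "1 \<le> k'" "k' \<le> ?l'" for k k'
        unfolding shift by (rule orbit_walk_disjoint) (use that q' p_def in auto)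
    qed (use q' p_def in auto)
    then show ?thesis by (rule rung_cycle_mono) (simp add: algebra_simps)
  qed
  then show ?thesis
    by (rule goodI[rotated -1]) (use n_pos dvd ne in \<open>simp_all add: algebra_simps\<close>)
qed

text \<open>The walk need not close up: the boundary of the ladder over it contains both end rungs.
  Such cycles fill the classes that a hexagon misses.\<close>

lemma rung_cycle_walk:
  assumes "a \<in> S" "\<not> n dvd int a"
  shows "rung_cycle (cls (gcd n (int a)) c)
    {vtx True c, vtx False (c + int (period (int a) - 1) * int a)}"
proof -
  define w where "w = walk (int a) c"
  define p where "p = period (int a)"
  have p: "p \<ge> 2" unfolding p_def by (rule period_ge_2[OF assms(2)])
  have adj_w: "adj (w k) (w (Suc k))" for k unfolding w_def by (rule adj_walk[OF assms(1)])
  have D: "orbit (w i) \<inter> orbit (w j) = {}" if "i < j" "j < 2 * p" for i j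
    unfolding w_def by (rule orbit_walk_disjoint) (use that p_def in auto)
  have "adj (w 0) (w 1)" "adj (w 1) (w 0)" using adj_w[of 0] adj_sym by auto
  \<comment> \<open>The degenerate cycle on two vertices has a genuine 4-cycle with two rungs as its
    zigzag.\<close>
  then have "cycle_edges [w 0, w 1] \<subseteq> edges" by (simp add: cycle_edges_def)
  moreover have "sorted_wrt (\<lambda>x y. orbit x \<inter> orbit y = {}) [w 0, w 1]"
    using D[of 0 1] p by simp
  ultimately have "rung_cycle (\<Union> (orbit ` set [w 0, w 1])) (set [w 0, w 1])"
    by (intro rung_cycle_zigzag_sorted) simp_all
  then have base: "rung_cycle (orbit (w 0) \<union> orbit (w 1)) {w 0, w 1}" by simp
  let ?l = "2 * p - 1"
  have "rung_cycle ((orbit (w 0) \<union> orbit (w 1)) \<union> (\<Union>k\<in>{1<..?l}. orbit (w k)))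
      ({w 0, w 1} - orbit (w 1) \<union> {w ?l})"
  proof (rule rung_cycle_extend_path[OF base])
    show "orbit (w i) \<inter> (orbit (w 0) \<union> orbit (w 1)) = {}" if "1 < i" "i \<le> ?l" for i
      using D[of 0 i] D[of 1 i] that by (simp only: Int_Un_distrib Int_commute) simp
    show "orbit (w i) \<inter> orbit (w j) = {}" if "1 < i" "i < j" "j \<le> ?l" for i j
      by (rule D) (use that in auto)
  qed (use p adj_w in auto)
  moreover have "(orbit (w 0) \<union> orbit (w 1)) \<union> (\<Union>k\<in>{1<..?l}. orbit (w k)) = cls (gcd n (int a)) c"
  proof -
    have "{0..<0 + 2 * p} = {0, 1} \<union> {1<..?l}" using p by auto
    then have "(\<Union>k\<in>{0..<0 + 2 * p}. orbit (w k)) =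
        (orbit (w 0) \<union> orbit (w 1)) \<union> (\<Union>k\<in>{1<..?l}. orbit (w k))"
      by (simp only: UN_Un UN_insert UN_empty Un_empty_right)
    then show ?thesis using orbits_walk_eq_cls[of "int a" c 0] unfolding p_def w_def by simp
  qed
  ultimately have *: "rung_cycle (cls (gcd n (int a)) c) ({w 0, w 1} - orbit (w 1) \<union> {w ?l})"
    by simp
  have "w 0 \<notin> orbit (w 1)" using D[of 0 1] p by auto
  then have "{w 0, w ?l} \<subseteq> {w 0, w 1} - orbit (w 1) \<union> {w ?l}" by simp
  then have "rung_cycle (cls (gcd n (int a)) c) {w 0, w ?l}" by (rule rung_cycle_mono[OF *])
  moreover have "w 0 = vtx True c" "w ?l = vtx False (c + int (p - 1) * int a)"
  proof -
    have "?l div 2 = p - 1" "odd ?l" using p by presburger+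
    then show "w 0 = vtx True c" "w ?l = vtx False (c + int (p - 1) * int a)"
      unfolding w_def walk_def by simp_all
  qed
  ultimately show ?thesis unfolding p_def by simp
qed

text \<open>The arcs fill the classes of \<open>c\<close> and \<open>c - b\<close>, and a chain of
  step \<open>b\<close> from the end of the first arc collects the other classes.\<close>

lemma good_hexagon_two_classes:
  assumes S: "a \<in> S" "b \<in> S"
    and ne: "\<not> n dvd int a" "\<not> n dvd int b" "\<not> n dvd int a - int b"
    and ndvd: "\<not> gcd n (int a) dvd int b"
  shows "good (gcd (gcd n (int a)) (int b))"
proof -
  define d where "d = gcd n (int a)"
  define g where "g = gcd d (int b)"
  define p where "p = period (int a)"
  define t where "t = nat (d div g)"
  \<comment> \<open>The offset of position \<open>2 * p - 1\<close>, where the first arc ends; it is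
    \<open>- a\<close> modulo \<open>n\<close>.\<close>
  define i where "i = int (p - 1) * int a"
  have p: "p \<ge> 2" unfolding p_def by (rule period_ge_2[OF ne(1)])
  have d: "d > 0" "d dvd n" "d dvd int a" using n_pos unfolding d_def by auto
  have g: "g > 0" "g dvd d" "g dvd int b" using d unfolding g_def by auto
  have int_t: "int t = d div gcd d (int b)"
    unfolding t_def g_def using class_count_pos[OF d(1), of "int b"] by simp
  have nd: "\<not> d dvd int k * int b" if "1 \<le> k" "k < t" for k
    by (rule not_dvd_multiple[OF d(1) that(1)]) (use that(2) int_t in linarith)
  have td: "d dvd int t * int b" unfolding dvd_mult_iff_div_gcd_dvd[OF d(1)] int_t by simp
  have "t \<noteq> 0" using class_count_pos[OF d(1), of "int b"] int_t by linarith
  moreover have "t \<noteq> 1" using td ndvd unfolding d_def by (intro notI) simp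
  ultimately have t: "t \<ge> 2" by linarith
  have i: "\<not> n dvd i" "d dvd i"
  proof -
    show "d dvd i" unfolding i_def using d(3) by simp
    have "n dvd int p * int a" unfolding period_dvd_iff p_def by simp
    moreover have "int p * int a = i + int a" unfolding i_def using p by (simp add: of_nat_diff algebra_simps)
    ultimately show "\<not> n dvd i" using ne(1) dvd_add_right_iff[of n i "int a"] by metis
  qed
  have "rung_cycle (cls g c) {vtx False c, vtx False (c + - int b),
      vtx True (c + 0), vtx True (c + (int a - int b))}" for c
  proof -
    define W where "W = cls d c \<union> cls d (c - int b)"
    define P where "P = {vtx False c, vtx False (c - int b), vtx True c,
        vtx True (c - int b + int a), vtx False (c + i)}"
    have hex: "rung_cycle W P"
    proof -
      let ?l = "2 * p - 1" and ?l' = "2 * p"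
      have l: "?l div 2 = p - 1" "odd ?l" using p by presburger+
      then have wl: "walk (int a) c ?l = vtx False (c + i)" unfolding walk_def i_def by simp
      have sets: "{..?l} = {0..<0 + 2 * p}" "{1..?l'} = {1..<1 + 2 * p}" using p by auto
      have W: "W = (\<Union>k\<in>{..?l}. orbit (walk (int a) c k)) \<union>
          (\<Union>k\<in>{1..?l'}. orbit (walk (int a) (c - int b) k))"
        unfolding sets unfolding p_def orbits_walk_eq_cls W_def d_def ..
      have "cls d c \<inter> cls d (c - int b) = {}"
        by (rule cls_disjoint[OF d(2)]) (use ndvd d_def in simp)
      then have cross: "orbit (walk (int a) c k) \<inter> orbit (walk (int a) (c - int b) k') = {}" for k k'
        using orbit_walk_subset[of "int a" c k] orbit_walk_subset[of "int a" "c - int b" k']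
        unfolding d_def by blast
      show ?thesis
        unfolding W P_def wl[symmetric]
        by (rule rung_cycle_hexagon[OF S ne]) (use cross p p_def in auto)
    qed
    \<comment> \<open>The chain stops at \<open>t - 2\<close> since the class of
      \<open>c + (t - 1) * b\<close> is that of \<open>c - b\<close>, already in
      \<open>W\<close>.\<close>
    have "rung_cycle (W \<union> (\<Union>k\<in>{1..t - 2}. cls d (c + int k * int b)))
        (P - orbit (vtx False (c + i)) \<union> {vtx False (c + i + int (t - 2) * (int b + i - 0))})"
    proof (rule rung_cycle_chain[OF d(2) i(2) _ _ _ adj_S[OF S(2)] hex])
      show "rung_cycle (cls d c) {vtx False (c + i), vtx True (c + 0)}" for c
        using rung_cycle_walk[OF S(1) ne(1), of c]
        unfolding d_def i_def p_def by (simp add: insert_commute)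
      show "cls d (c + int k * int b) \<inter> W = {}" if "1 \<le> k" "k \<le> t - 2" for k
      proof -
        have "\<not> d dvd int (Suc k) * int b" by (rule nd) (use that t in auto)
        then have "cls d (c + int k * int b) \<inter> cls d (c - int b) = {}"
          by (intro cls_disjoint[OF d(2)]) (simp add: algebra_simps)
        moreover have "cls d (c + int k * int b) \<inter> cls d c = {}"
          by (rule cls_disjoint[OF d(2)]) (use nd[of k] that t in simp)
        ultimately show ?thesis unfolding W_def by blast
      qed
      show "\<not> d dvd int k * int b" if "1 \<le> k" "k \<le> t - 2" for k
        by (rule nd) (use that t in auto)
    qed (simp_all add: P_def)
    moreover have "W \<union> (\<Union>k\<in>{1..t - 2}. cls d (c + int k * int b)) = cls g c"
    proof -
      have "{..<t} = {0, t - 1} \<union> {1..t - 2}" using t by auto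
      moreover have "cls d (c - int b) = cls d (c + int (t - 1) * int b)"
      proof (rule cls_cong)
        have "c - int b - (c + int (t - 1) * int b) = - (int t * int b)"
          using t by (simp add: of_nat_diff algebra_simps)
        then show "d dvd c - int b - (c + int (t - 1) * int b)" using td by simp
      qed
      ultimately show ?thesis
        unfolding W_def g_def cls_gcd[OF d(1,2)] t_def[unfolded g_def, symmetric] by auto
    qed
    ultimately have *: "rung_cycle (cls g c)
        (P - orbit (vtx False (c + i)) \<union> {vtx False (c + i + int (t - 2) * (int b + i - 0))})" by simp
    \<comment> \<open>The rung at offset \<open>i\<close>, used up by the chain, is neither of the
      two \<open>u\<close> rungs to be kept.\<close>
    have "\<not> n dvd - i" using i(1) by simp
    moreover have "\<not> n dvd - i - int b"
    proof
      assume "n dvd - i - int b"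
      from dvd_add[OF dvd_trans[OF d(2) this] i(2)] show False using ndvd unfolding d_def by simp
    qed
    ultimately have "vtx False c \<notin> orbit (vtx False (c + i))"
        "vtx False (c - int b) \<notin> orbit (vtx False (c + i))"
        "vtx True j \<notin> orbit (vtx False (c + i))" for j
      unfolding vtx_in_orbit_iff by (simp_all add: algebra_simps)
    then show ?thesis
      by (intro rung_cycle_mono[OF *]) (simp add: P_def algebra_simps)
  qed
  moreover have "g dvd n" "g dvd int a - int b"
    using dvd_trans[OF g(2)] d(2,3) g(3) by (auto intro: dvd_diff)
  ultimately have "good g"
    by (intro goodI[of g "- int b" 0 "int a - int b"]) (use g ne in simp_all)
  then show ?thesis unfolding g_def d_def .
qed

section \<open>Closed walks through all of their rungs\<close>

lemma path_edges_map_upt: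
  assumes "\<And>k. adj (f k) (f (Suc k))"
  shows "path_edges (map f [i..<j]) \<subseteq> edges"
proof (induction j)
  case (Suc j)
  show ?case
  proof (cases "i < j")
    case True
    then obtain j' where j': "j = Suc j'" "i \<le> j'" by (cases j) auto
    then have "path_edges (map f [i..<Suc j]) = insert {f j', f j} (path_edges (map f [i..<j]))"
      using path_edges_append[of "map f [i..<j]" "[f j]"] by (simp add: last_map)
    then show ?thesis using Suc assms[of j'] j'(1) by simp
  next
    case False
    then show ?thesis by (cases "i = j") auto
  qed
qed simp

text \<open>The zigzag of the closed walk contains every rung of the class, so any two on each side
  serve. The side where the walk starts is selected by \<open>k0\<close>.\<close>

lemma good_closed_walk:
  assumes "a \<in> S" "\<not> n dvd int a" "k0 \<le> 1"
    and close: "\<And>c. adj (walk (int a) c (k0 + 2 * period (int a) - 1)) (walk (int a) c k0)"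
  shows "good (gcd n (int a))"
proof -
  define p where "p = period (int a)"
  have p: "p \<ge> 2" unfolding p_def by (rule period_ge_2[OF assms(2)])
  have "rung_cycle (cls (gcd n (int a)) c) {vtx False c, vtx False (c + int a),
      vtx True (c + int k0 * int a), vtx True (c + (int k0 + 1) * int a)}" for c
  proof -
    define w where "w = walk (int a) c"
    define xs where "xs = map w [k0..<k0 + 2 * p]"
    have "path_edges xs \<subseteq> edges"
      unfolding xs_def w_def by (intro path_edges_map_upt adj_walk assms(1))
    moreover have "last xs = w (k0 + 2 * p - 1)" "hd xs = w k0"
      unfolding xs_def using p by (simp_all add: last_map hd_map)
    ultimately have edges: "cycle_edges xs \<subseteq> edges"
      unfolding cycle_edges_def using close[of c] p_def w_def by simp
    have sorted: "sorted_wrt (\<lambda>x y. orbit x \<inter> orbit y = {}) xs"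
      unfolding xs_def sorted_wrt_iff_nth_less
    proof (intro allI impI)
      fix i j assume "i < j" "j < length (map w [k0..<k0 + 2 * p])"
      then show "orbit (map w [k0..<k0 + 2 * p] ! i) \<inter> orbit (map w [k0..<k0 + 2 * p] ! j) = {}"
        using orbit_walk_disjoint[of "k0 + i" "k0 + j" "int a" c] unfolding w_def p_def by simp
    qed
    have "rung_cycle (\<Union> (orbit ` set xs)) (set xs)"
      by (rule rung_cycle_zigzag_sorted[OF _ _ edges sorted]) (use p in \<open>auto simp: xs_def\<close>)
    moreover have "\<Union> (orbit ` set xs) = cls (gcd n (int a)) c"
      using orbits_walk_eq_cls[of "int a" c k0] unfolding xs_def w_def p_def by (simp add: image_image)
    moreover have "{w 1, w 3, w (2 * k0), w (2 * k0 + 2)} \<subseteq> set xs"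
      unfolding xs_def using p assms(3) by auto
    ultimately have "rung_cycle (cls (gcd n (int a)) c) {w 1, w 3, w (2 * k0), w (2 * k0 + 2)}"
      using rung_cycle_mono by metis
    then show ?thesis unfolding w_def walk_def by (simp add: add.commute)
  qed
  then show ?thesis
    by (intro goodI[of _ "int a" "int k0 * int a" "(int k0 + 1) * int a"])
      (use n_pos assms(2) in \<open>simp_all add: algebra_simps\<close>)
qed

section \<open>Existence of a good divisor\<close>

lemma m_dvd_imp_0: "int m dvd k \<Longrightarrow> \<bar>k\<bar> < int m \<Longrightarrow> k = 0"
  using dvd_imp_le_int[of k "int m"] by force

text \<open>If \<open>0\<close>, \<open>a\<close>, \<open>b\<close> are distinct modulo
  \<open>n\<close>, a hexagon applies. Otherwise two of them differ by \<open>n\<close> modulo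
  \<open>m\<close>, and the choice between them adjusts the closing edge of a walk.\<close>

lemma ex_good:
  assumes "S \<subseteq> {..<m}" "card S \<ge> 3"
  shows "\<exists>d. good d"
proof -
  have mult: "x = 0 \<or> x = m div 2" if x: "x \<in> S" "n dvd int x" for x
  proof -
    have "x < m" using that assms(1) by auto
    consider "int m dvd int x" | "int m dvd int x - n" using x(2) n_dvd_iff[of "int x"] by blast
    then show ?thesis
    proof cases
      case 1
      then show ?thesis using m_dvd_imp_0[of "int x"] \<open>x < m\<close> by simp
    next
      case 2
      then have "int x - n = 0" using m_dvd_imp_0[of "int x - n"] \<open>x < m\<close> n_pos int_m by linarith
      then show ?thesis unfolding n_def by simp
    qed
  qed
  have large: "\<not> S \<subseteq> {x, y}" for x y
  proof
    assume "S \<subseteq> {x, y}"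
    then have "card S \<le> card {x, y}" by (intro card_mono) auto
    also have "\<dots> \<le> 2" by (simp add: card_insert_if)
    finally show False using assms(2) by simp
  qed
  obtain a where a: "a \<in> S" "\<not> n dvd int a" using large[of 0 "m div 2"] mult by blast
  obtain b where b: "b \<in> S" "b \<noteq> 0" "b \<noteq> a" using large[of 0 a] by blast
  let ?p = "period (int a)"
  have p: "?p \<ge> 2" by (rule period_ge_2[OF a(2)])
  have "n dvd int ?p * int a" unfolding period_dvd_iff by simp
  then consider (zero) "int m dvd int ?p * int a" | (half) "int m dvd int ?p * int a - n"
    unfolding n_dvd_iff[of "int ?p * int a"] by blast
  note pa = this
  have closeI: "adj (vtx False x) (vtx True y)" if "s \<in> S" "int m dvd x + int s - y" for x y s
    using adj_S[OF that(1), of x] that(2) vtx_eq_iff by metis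
  show ?thesis
  proof (cases "n dvd int b")
    case True
    then have "int b = n" using mult[OF b(1)] b(2) unfolding n_def by simp
    \<comment> \<open>Starting at \<open>u_c\<close>, the closing edge has step
      \<open>?p * a\<close>, which is \<open>0\<close> or \<open>n = b\<close> modulo
      \<open>m\<close>.\<close>
    have "adj (walk (int a) c (1 + 2 * ?p - 1)) (walk (int a) c 1)" for c
    proof (rule adj_sym)
      have "adj (vtx False c) (vtx True (c + int ?p * int a))"
        using pa
      proof cases
        case zero
        then show ?thesis by (intro closeI[OF zero_mem]) (simp add: dvd_diff_commute)
      next
        case half
        then show ?thesis by (intro closeI[OF b(1)]) (simp add: \<open>int b = n\<close> dvd_diff_commute)
      qed
      then show "adj (walk (int a) c 1) (walk (int a) c (1 + 2 * ?p - 1))"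
        unfolding walk_def by simp
    qed
    then show ?thesis using good_closed_walk[OF a, of 1] by blast
  next
    case False
    show ?thesis
    proof (cases "n dvd int a - int b")
      case True
      have "\<not> int m dvd int a - int b"
      proof
        assume "int m dvd int a - int b"
        moreover have "a < m" "b < m" using a(1) b(1) assms(1) by auto
        then have "\<bar>int a - int b\<bar> < int m" by linarith
        ultimately show False using m_dvd_imp_0[of "int a - int b"] b(3) by simp
      qed
      then have ab: "int m dvd int a - int b - n" using True n_dvd_iff[of "int a - int b"] by blast
      \<comment> \<open>Starting at \<open>v_c\<close>, the closing edge has step
        \<open>a - ?p * a\<close>, which is \<open>a\<close> or \<open>a - n\<close> modulo
        \<open>m\<close>, and the latter is \<open>b\<close>.\<close>
      have "adj (walk (int a) c (0 + 2 * ?p - 1)) (walk (int a) c 0)" for c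
      proof -
        have *: "int (?p - 1) * int a = int ?p * int a - int a"
          using p by (simp add: of_nat_diff algebra_simps)
        have "adj (vtx False (c + int (?p - 1) * int a)) (vtx True c)"
          using pa
        proof cases
          case zero
          then show ?thesis by (intro closeI[OF a(1)]) (unfold *, simp)
        next
          case half
          have "int m dvd int ?p * int a - n - (int a - int b - n)" by (rule dvd_diff[OF half ab])
          then show ?thesis by (intro closeI[OF b(1)]) (unfold *, simp add: algebra_simps)
        qed
        moreover have "(2 * ?p - 1) div 2 = ?p - 1" "odd (2 * ?p - 1)" using p by presburger+
        ultimately show ?thesis unfolding walk_def by simp
      qed
      then show ?thesis using good_closed_walk[OF a, of 0] by blast
    next
      case ne: False
      then show ?thesis
        using good_hexagon_same_class[OF a(1) b(1) a(2) False ne]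
          good_hexagon_two_classes[OF a(1) b(1) a(2) False ne] by blast
    qed
  qed
qed

section \<open>The least good divisor and connectedness\<close>

lemma good_dvd_all:
  assumes "\<exists>d. good d"
  obtains d where "good d" "\<And>s. s \<in> R \<union> S \<union> T \<Longrightarrow> d dvd int s"
proof -
  define k where "k = (LEAST k. good (int k))"
  have "\<exists>k. good (int k)" using assms unfolding good_def by (metis zero_less_imp_eq_int)
  then have good: "good (int k)" unfolding k_def by (rule LeastI_ex)
  have "int k dvd int s" if "s \<in> R \<union> S \<union> T" for s
  proof -
    have "good (int (gcd k s))" using good_gcd[OF good that] by simp
    then have "k \<le> gcd k s" unfolding k_def by (rule Least_le)
    moreover have "k > 0" using good unfolding good_def by simp
    ultimately have "gcd k s = k" by (meson gcd_dvd1 dvd_imp_le le_antisym)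
    then show ?thesis by (metis gcd_dvd2 of_nat_dvd_iff)
  qed
  then show ?thesis using good that by blast
qed

text \<open>Up to sign and multiples of \<open>m\<close>, an edge changes the index by an element of
  \<open>R\<close>, \<open>S\<close> or \<open>T\<close>. Connectedness will leave only
  \<open>d = 1\<close>.\<close>

lemma adj_imp_dvd_diff:
  assumes "d dvd n" "\<And>s. s \<in> R \<union> S \<union> T \<Longrightarrow> d dvd int s" "adj x y"
  shows "d dvd int (snd y) - int (snd x)"
proof -
  have *: "d dvd int ((i + s) mod m) - int i" if "s \<in> R \<union> S \<union> T" for i s
  proof -
    have "int m dvd int ((i + s) mod m) - (int i + int s)"
      by (metis mod_eq_dvd_iff mod_mod_trivial of_nat_add zmod_int)
    then have "d dvd (int ((i + s) mod m) - (int i + int s)) + int s"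
      using dvd_n_dvd_m[OF assms(1)] assms(2)[OF that] by (intro dvd_add)
    then show ?thesis by simp
  qed
  then show ?thesis
    using assms(3) *[of _ "snd x"] *[of _ "snd y"] unfolding bic_adj_def
    by (auto simp: dvd_diff_commute)
qed

end

theorem theorem1p4:
  fixes m :: nat and R S T :: "nat set"
  assumes "R \<subseteq> {..<m}" and "S \<subseteq> {..<m}" and "T \<subseteq> {..<m}"
    and "symm_mod m R" and "symm_mod m T"
    and "0 \<notin> R" and "0 \<notin> T" and "0 \<in> S"
    and "card R = card T"
    and "graph_connected (bic_verts m) (bic_adj m R S T)"
    and "even m" and "m \<ge> 4" and "card S \<ge> 3"
    and "m div 2 \<in> R" and "m div 2 \<in> T"
  shows "hamiltonian (bic_verts m) (bic_adj m R S T)"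
proof -
  interpret bicirculant m R S T
    using assms by unfold_locales auto
  obtain d where d: "good d" "\<And>s. s \<in> R \<union> S \<union> T \<Longrightarrow> d dvd int s"
    using good_dvd_all[OF ex_good[OF assms(2,13)]] by metis
  have "d > 0" "d dvd n" using d(1) unfolding good_def by blast+
  have "d dvd int (snd y) - int (snd x)"
    if "(x, y) \<in> {(a, b). a \<in> bic_verts m \<and> b \<in> bic_verts m \<and> adj a b}\<^sup>*" for x y
    using that
  proof (induction rule: rtrancl_induct)
    case (step y z)
    then have "d dvd int (snd z) - int (snd y)"
      by (intro adj_imp_dvd_diff[OF \<open>d dvd n\<close> d(2)]) auto
    from dvd_add[OF this step.IH] show ?case by simp
  qed simp
  \<comment> \<open>A path from \<open>u_0\<close> to \<open>u_1\<close> forces \<open>d\<close> to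
    divide \<open>1\<close>.\<close>
  moreover have "((False, 0), (False, 1)) \<in> {(a, b). a \<in> bic_verts m \<and> b \<in> bic_verts m \<and> adj a b}\<^sup>*"
    using assms(10,12) unfolding graph_connected_def bic_verts_def by simp
  ultimately have "d dvd 1" by fastforce
  then have "d = 1" using \<open>d > 0\<close> by simp
  then obtain P where "rung_cycle (cls 1 0) P" using d(1) unfolding good_def by blast
  moreover have "cls 1 0 = bic_verts m"
  proof (intro subset_antisym subsetI)
    fix x assume "x \<in> bic_verts m"
    then have "x = vtx (fst x) (int (snd x))"
      by (intro vtx_of_pair) (auto simp: bic_verts_def)
    then show "x \<in> cls 1 0" unfolding cls_def by auto
  qed (use m_pos in \<open>auto simp: cls_def vtx_def bic_verts_def nat_less_iff\<close>)
  ultimately obtain xs where xs: "distinct xs" "set xs = bic_verts m" "cycle_edges xs \<subseteq> edges"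
    unfolding rung_cycle_def by auto
  \<comment> \<open>Counting vertices rules out a degenerate cycle.\<close>
  have "length xs = card (bic_verts m)" using distinct_card[OF xs(1)] xs(2) by simp
  also have "\<dots> = 2 * m" by (simp add: bic_verts_def card_cartesian_product)
  finally have "length xs \<ge> 3" using assms(12) by simp
  then show ?thesis
    using hamiltonianI[of adj xs] adj_sym xs unfolding edges_def by metis
qed

end
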